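(* For each $\varepsilon>0$ there exists $n_0=n_0(\varepsilon)$ such that the following holds for every $d\geq 10^{-5}$ and $n\geq n_0$. Let $D$ be an $n$-vertex $(d,\varepsilon)$-pseudorandom digraph containing disjoint vertex sets $A$ and $V$ with \[\frac{n\log^{[2]}n}{\log n\cdot \log^{[4]}n}\leq |A|\leq \frac{n(\log^{[2]}n)^3}{\log n}\] and $|V|\leq |A|/\log^{[6]}n$, such that, with $m=n\log^{[3]}n/(d\log n)$: (i) for each $v\in A\cup V$, $d^\pm(v,A)\geq 40d\log^{[2]}n/\log^{[4]}n$ and $d^\pm(v,A\cup V)\leq d(\log^{[2]}n)^3$; (ii) for each $U\subset A\cup V$ with $|U|=m$, $|N^\pm(U,A)|\geq (1/2+\varepsilon/8)|A|$. Then $V$ is weakly connected in $D[A\cup V]$.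
   Context: $\log$ is natural and $\log^{[k]}n$ is the $k$-fold iterated logarithm of $n$. For a digraph $D$ and $U\subset V(D)$, $N^+(U)$ ($N^-(U)$) is the set of vertices outside $U$ with an in-neighbour (out-neighbour) in $U$; $N^\pm(U,A)=N^\pm(U)\cap A$; $d^\pm(v,A)$ is the number of out-/in-neighbours of $v$ in $A$; statements with $\pm$ hold for both $+$ and $-$. An $n$-vertex digraph $D$ is $(d,\varepsilon)$-pseudorandom if, with $m=n\log^{[3]}n/(d\log n)$: (A1) $\delta^\pm(D)\geq d\log n$ and $\Delta^\pm(D)\leq 10^6 d\log n$; (A2) for each $j\in\{+,-\}$ and disjoint $A,B$ with $|A|\leq 2m$ and $d^j(v,B)\geq d\log^{[2]}n/\log^{[4]}n$ for all $v\in A$, $|B|\geq 10|A|$; (A3) for each $j\in\{+,-\}$ and disjoint $A,B$ with $|A|\leq 2m$ and $d^j(v,B)\geq d(\log n)^{2/3}$ for all $v\in A$, $|B|\geq(\log n)^{1/3}|A|$; (A4) every $A$ with $|A|=m$ has $|N^\pm(A)|\geq(1/2+\varepsilon)n$. A vertex set $U$ in a digraph $D'$ is weakly connected in $D'$ if for any set $E$ of pairwise vertex-disjoint directed edges with both endpoints in $U$, there is a directed cycle in $D'+E$ containing every edge of $E$. *)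

theory Defs
  imports Complex_Main "Graph_Theory.Graph_Theory"
begin

definition ilog :: "nat \<Rightarrow> real \<Rightarrow> real" where
  "ilog k x = (ln ^^ k) x"

text \<open>The superscript \<open>+\<close> or \<open>-\<close>: \<open>Plus\<close> refers to out-neighbours, \<open>Minus\<close> to in-neighbours.\<close>

datatype dirn = Plus | Minus

fun is_nbr :: "('a, 'b) pre_digraph \<Rightarrow> dirn \<Rightarrow> 'a \<Rightarrow> 'a \<Rightarrow> bool" where
  "is_nbr D Plus v w \<longleftrightarrow> v \<rightarrow>\<^bsub>D\<^esub> w"
| "is_nbr D Minus v w \<longleftrightarrow> w \<rightarrow>\<^bsub>D\<^esub> v"

definition nbhd :: "('a, 'b) pre_digraph \<Rightarrow> dirn \<Rightarrow> 'a set \<Rightarrow> 'a set" where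
  "nbhd D s U = {w \<in> verts D - U. \<exists>u\<in>U. is_nbr D s u w}"

definition deg_in :: "('a, 'b) pre_digraph \<Rightarrow> dirn \<Rightarrow> 'a \<Rightarrow> 'a set \<Rightarrow> nat" where
  "deg_in D s v A = card {w \<in> A. is_nbr D s v w}"

fun semidegree :: "('a, 'b) pre_digraph \<Rightarrow> dirn \<Rightarrow> 'a \<Rightarrow> nat" where
  "semidegree D Plus v = out_degree D v"
| "semidegree D Minus v = in_degree D v"

definition min_semidegree :: "('a, 'b) pre_digraph \<Rightarrow> dirn \<Rightarrow> nat" where
  "min_semidegree D s = Min (semidegree D s ` verts D)"

definition max_semidegree :: "('a, 'b) pre_digraph \<Rightarrow> dirn \<Rightarrow> nat" where
  "max_semidegree D s = Max (semidegree D s ` verts D)"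

text \<open>The quantity \<open>m\<close> is a real number in general. Upper bounds such as \<open>|A| \<le> 2m\<close> use this
  real number; a set ``of size \<open>m\<close>'' is a set of size \<open>m\<close> rounded up.\<close>

definition mparam :: "nat \<Rightarrow> real \<Rightarrow> real" where
  "mparam n d = real n * ilog 3 (real n) / (d * ln (real n))"

definition pseudorandom :: "real \<Rightarrow> real \<Rightarrow> ('a, 'b) pre_digraph \<Rightarrow> bool" where
  "pseudorandom d \<epsilon> D \<longleftrightarrow>
    (let n = card (verts D); m = mparam n d in
      (\<forall>s. real (min_semidegree D s) \<ge> d * ln (real n) \<and>
           real (max_semidegree D s) \<le> 10 ^ 6 * d * ln (real n)) \<and>
      (\<forall>s A B. A \<subseteq> verts D \<and> B \<subseteq> verts D \<and> A \<inter> B = {} \<and> real (card A) \<le> 2 * m \<and>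
           (\<forall>v\<in>A. real (deg_in D s v B) \<ge> d * ilog 2 (real n) / ilog 4 (real n)) \<longrightarrow>
           card B \<ge> 10 * card A) \<and>
      (\<forall>s A B. A \<subseteq> verts D \<and> B \<subseteq> verts D \<and> A \<inter> B = {} \<and> real (card A) \<le> 2 * m \<and>
           (\<forall>v\<in>A. real (deg_in D s v B) \<ge> d * ln (real n) powr (2 / 3)) \<longrightarrow>
           real (card B) \<ge> ln (real n) powr (1 / 3) * real (card A)) \<and>
      (\<forall>s A. A \<subseteq> verts D \<and> card A = nat \<lceil>m\<rceil> \<longrightarrow>
           real (card (nbhd D s A)) \<ge> (1 / 2 + \<epsilon>) * real n))"

text \<open>\<open>D + E\<close>, as a digraph whose arcs are ordered pairs (so edges of \<open>E\<close> already present in \<open>D\<close>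
  are not duplicated).\<close>

definition add_edges :: "('a, 'b) pre_digraph \<Rightarrow> ('a \<times> 'a) set \<Rightarrow> 'a pair_pre_digraph" where
  "add_edges D E = \<lparr> pverts = verts D, parcs = arcs_ends D \<union> E \<rparr>"

definition disjoint_edges_on :: "'a set \<Rightarrow> ('a \<times> 'a) set \<Rightarrow> bool" where
  "disjoint_edges_on U E \<longleftrightarrow>
    E \<subseteq> U \<times> U \<and> (\<forall>e\<in>E. fst e \<noteq> snd e) \<and>
    (\<forall>e\<in>E. \<forall>f\<in>E. e \<noteq> f \<longrightarrow> {fst e, snd e} \<inter> {fst f, snd f} = {})"

definition weakly_connected_in :: "'a set \<Rightarrow> ('a, 'b) pre_digraph \<Rightarrow> bool" where
  "weakly_connected_in U D \<longleftrightarrow>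
    (\<forall>E. disjoint_edges_on U E \<longrightarrow>
      (\<exists>p. pre_digraph.cycle (with_proj (add_edges D E)) p \<and> E \<subseteq> set p))"

end

(*
  Idea. Regard (v, s), for a vertex v of A Un V and a sign s, as a left vertex joined to the s-neighbours
  of v in A. By (A2), after passing to a good bipartition of the set in question, and by (ii) for sets of
  size at least m, this bipartite graph expands, so that a Friedman-Pippenger type condition holds: every
  small set X of left vertices has at least sum f X neighbours in the set F of free vertices, where f
  prescribes how many children each left vertex may still claim. The condition survives suitable greedy
  extensions of a forest, and deleting leaves restores it for free. Both signs share one condition, since
  a vertex put on a path is lost for out- and in-neighbourhoods alike.

  Start with the edges of E as t = |E| disjoint paths and merge them one pair at a time. Grow out-trees
  from the ends of about t/2 of the paths and in-trees from the starts of as many others, to depth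
  k ~ log(m/t), so that each forest has at least m leaves. By (ii) many free vertices are both out-neighbours
  of the first leaves and in-neighbours of the second ones; one of them can be used without violating the
  condition. All tree edges off the resulting path are then given back. A merger costs 2k + 1 vertices, and
  the sum of log(m/t) over t is O(m), so the total cost |E| + O(m) is small compared with |A|. The last
  remaining path is closed up to a cycle in the same way.
*)
theory Submission
  imports Defs "HOL-Real_Asymp.Real_Asymp"
begin

section \<open>Extendable demands\<close>

text \<open>\<open>f x\<close> is the number of neighbours in the free set \<open>F\<close> that the left vertex \<open>x\<close> may still claim
  for itself; the Hall condition is required of sets of at most \<open>K\<close> left vertices only.\<close>

definition extendable :: "('x \<Rightarrow> 'b set) \<Rightarrow> 'x set \<Rightarrow> nat \<Rightarrow> ('x \<Rightarrow> nat) \<Rightarrow> 'b set \<Rightarrow> bool" where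
  "extendable N L K f F \<longleftrightarrow>
    (\<forall>X\<subseteq>L. card X \<le> K \<longrightarrow> sum f X \<le> card (\<Union>(N ` X) \<inter> F))"

lemma extendable_mono:
  assumes "extendable N L K f F" "\<And>x. x \<in> L \<Longrightarrow> g x \<le> f x"
  shows "extendable N L K g F"
  unfolding extendable_def
proof (intro allI impI)
  fix X assume X: "X \<subseteq> L" "card X \<le> K"
  have "sum g X \<le> sum f X" using assms(2) X by (intro sum_mono) auto
  then show "sum g X \<le> card (\<Union>(N ` X) \<inter> F)"
    using assms(1) X unfolding extendable_def by (meson order_trans)
qed

text \<open>Submodularity of the neighbourhood size makes the union of two tight sets tight; \<open>big\<close> keeps
  the union within the size for which the condition is available.\<close>

lemma max_tight_set:
  assumes ext: "extendable N L (2 * K) f F"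
    and fin: "finite L" "finite F" and L': "L' \<subseteq> L" and K: "K > 0"
    and big: "\<forall>X\<subseteq>L. K \<le> card X \<and> card X \<le> 2 * K \<longrightarrow> sum f X < card (\<Union>(N ` X) \<inter> F)"
  shows "\<exists>X\<subseteq>L'. card X < K \<and> card (\<Union>(N ` X) \<inter> F) = sum f X \<and>
    (\<forall>Y\<subseteq>L'. card Y \<le> 2 * K \<and> card (\<Union>(N ` Y) \<inter> F) = sum f Y \<longrightarrow> Y \<subseteq> X)"
proof -
  define C where "C = {X. X \<subseteq> L' \<and> card X \<le> 2 * K \<and> card (\<Union>(N ` X) \<inter> F) = sum f X}"
  have finL': "finite L'" using fin L' by (rule_tac finite_subset)
  have small: "card X < K" if "X \<in> C" for X
  proof (rule ccontr)
    assume "\<not> card X < K"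
    moreover have "X \<subseteq> L" "card X \<le> 2 * K" "card (\<Union>(N ` X) \<inter> F) = sum f X"
      using that L' unfolding C_def by auto
    ultimately show False using big[rule_format, of X] by simp
  qed
  have un: "X \<union> Y \<in> C" if X: "X \<in> C" and Y: "Y \<in> C" for X Y
  proof -
    have fX: "finite X" "finite Y" using X Y finL' unfolding C_def by (auto intro: finite_subset)
    have XY: "X \<subseteq> L'" "Y \<subseteq> L'" using X Y unfolding C_def by auto
    have c: "card (X \<union> Y) \<le> 2 * K" using card_Un_le[of X Y] small[OF X] small[OF Y] by linarith
    have c': "card (X \<inter> Y) \<le> 2 * K"
      using small[OF X] card_mono[OF fX(1), of "X \<inter> Y"] by simp
    have 1: "sum f (X \<union> Y) \<le> card (\<Union>(N ` (X \<union> Y)) \<inter> F)"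
      using ext[unfolded extendable_def, rule_format, of "X \<union> Y"] c XY L' by blast
    have "sum f (X \<inter> Y) \<le> card (\<Union>(N ` (X \<inter> Y)) \<inter> F)"
      using ext[unfolded extendable_def, rule_format, of "X \<inter> Y"] c' XY L' by blast
    also have "\<dots> \<le> card ((\<Union>(N ` X) \<inter> F) \<inter> (\<Union>(N ` Y) \<inter> F))"
      using fin by (intro card_mono) auto
    finally have 2: "sum f (X \<inter> Y) \<le> card ((\<Union>(N ` X) \<inter> F) \<inter> (\<Union>(N ` Y) \<inter> F))" .
    have eq: "\<Union>(N ` (X \<union> Y)) \<inter> F = (\<Union>(N ` X) \<inter> F) \<union> (\<Union>(N ` Y) \<inter> F)" by auto
    have 3: "card (\<Union>(N ` X) \<inter> F) + card (\<Union>(N ` Y) \<inter> F)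
        = card (\<Union>(N ` (X \<union> Y)) \<inter> F) + card ((\<Union>(N ` X) \<inter> F) \<inter> (\<Union>(N ` Y) \<inter> F))"
      unfolding eq using fin by (intro card_Un_Int) auto
    have 4: "sum f X + sum f Y = sum f (X \<union> Y) + sum f (X \<inter> Y)"
      using fX by (simp add: sum.union_inter)
    \<comment> \<open>Since \<open>X\<close> and \<open>Y\<close> are tight, facts 3 and 4 give 1
      and 2 the same total on both sides, so both inequalities are equalities.\<close>
    have "card (\<Union>(N ` (X \<union> Y)) \<inter> F) = sum f (X \<union> Y)"
      using 1 2 3 4 X Y unfolding C_def by auto
    then show ?thesis using XY c unfolding C_def by auto
  qed
  have "finite C" using finL' unfolding C_def by simp
  moreover have "{} \<in> C" unfolding C_def by simp
  ultimately have top: "\<Union>C \<in> C" using un by (intro finite_Sup_in) auto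
  have "Y \<subseteq> \<Union>C" if "Y \<subseteq> L'" "card Y \<le> 2 * K" "card (\<Union>(N ` Y) \<inter> F) = sum f Y" for Y
    using that unfolding C_def by blast
  moreover have "\<Union>C \<subseteq> L'" "card (\<Union>(N ` \<Union>C) \<inter> F) = sum f (\<Union>C)"
    using top unfolding C_def by auto
  ultimately show ?thesis using small[OF top] by blast
qed

lemma extendable_remove:
  assumes ext: "extendable N L (2 * K) f F"
    and fin: "finite L" "finite F" and K: "K > 0"
    and big: "\<forall>X\<subseteq>L. K \<le> card X \<and> card X \<le> 2 * K \<longrightarrow> sum f X < card (\<Union>(N ` X) \<inter> F)"
    and f: "\<And>x. x \<in> L \<Longrightarrow> f x \<le> c"
    and Z: "Z \<subseteq> F" "card Z \<ge> c * K" and c: "c > 0"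
  obtains z where "z \<in> Z" "extendable N L (2 * K) f (F - {z})"
proof -
  obtain X where X: "X \<subseteq> L" "card X < K" "card (\<Union>(N ` X) \<inter> F) = sum f X"
    and max: "\<forall>Y\<subseteq>L. card Y \<le> 2 * K \<and> card (\<Union>(N ` Y) \<inter> F) = sum f Y \<longrightarrow> Y \<subseteq> X"
    using max_tight_set[OF ext fin subset_refl K big] by metis
  have "sum f X \<le> card X * c" using X f by (intro sum_bounded_above[of X f c, simplified]) auto
  also have "\<dots> < c * K" using X c by simp
  finally have "card (\<Union>(N ` X) \<inter> F) < card Z" using X Z by simp
  then have "\<not> Z \<subseteq> \<Union>(N ` X) \<inter> F" using fin by (meson card_mono finite_Int leD)
  then obtain z where z: "z \<in> Z" "z \<notin> \<Union>(N ` X)" using Z by auto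
  have "sum f Y \<le> card (\<Union>(N ` Y) \<inter> (F - {z}))" if Y: "Y \<subseteq> L" "card Y \<le> 2 * K" for Y
  proof (cases "z \<in> \<Union>(N ` Y)")
    case False
    then have "\<Union>(N ` Y) \<inter> (F - {z}) = \<Union>(N ` Y) \<inter> F" by auto
    then show ?thesis using ext Y unfolding extendable_def by auto
  next
    case True
    have "card (\<Union>(N ` Y) \<inter> F) \<noteq> sum f Y" using max[rule_format, of Y] Y True z by blast
    then have "sum f Y < card (\<Union>(N ` Y) \<inter> F)"
      using ext[unfolded extendable_def, rule_format, of Y] Y by linarith
    moreover have "\<Union>(N ` Y) \<inter> (F - {z}) = (\<Union>(N ` Y) \<inter> F) - {z}" by auto
    ultimately show ?thesis using True z Z fin by (simp add: card_Diff_singleton subset_iff)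
  qed
  then show ?thesis using that z unfolding extendable_def by auto
qed

text \<open>Handing \<open>y\<close> to \<open>x\<close> costs a set containing \<open>x\<close> at
  most one neighbour and exactly one unit of demand, so only sets avoiding \<open>x\<close> are in
  danger. They are safe if \<open>y\<close> lies outside the neighbourhood of the largest tight set
  \<open>X\<close> that avoids \<open>x\<close>. Such a \<open>y\<close> exists in
  \<open>N x\<close>, because adding \<open>x\<close> to \<open>X\<close> raises the demand strictly
  and the condition still holds for the enlarged set.\<close>

lemma extendable_extend:
  assumes ext: "extendable N L (2 * K) f F"
    and fin: "finite L" "finite F" and K: "K > 0"
    and big: "\<forall>X\<subseteq>L. K \<le> card X \<and> card X \<le> 2 * K \<longrightarrow> sum f X < card (\<Union>(N ` X) \<inter> F)"
    and x: "x \<in> L" "f x > 0"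
  obtains y where "y \<in> N x" "y \<in> F" "extendable N L (2 * K) (f(x := f x - 1)) (F - {y})"
proof -
  obtain X where X: "X \<subseteq> L - {x}" "card X < K" "card (\<Union>(N ` X) \<inter> F) = sum f X"
    and max: "\<forall>Y\<subseteq>L - {x}. card Y \<le> 2 * K \<and> card (\<Union>(N ` Y) \<inter> F) = sum f Y \<longrightarrow> Y \<subseteq> X"
    using max_tight_set[OF ext fin Diff_subset K big] by metis
  have finX: "finite X" using X fin by (meson finite_Diff finite_subset)
  have ins: "card (insert x X) \<le> 2 * K" "insert x X \<subseteq> L" "x \<notin> X"
    using X x finX by (auto simp: card_insert_if)
  have "sum f X < sum f (insert x X)" using ins finX x by simp
  also have "\<dots> \<le> card (\<Union>(N ` insert x X) \<inter> F)" using ext ins unfolding extendable_def by blast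
  finally have "card (\<Union>(N ` X) \<inter> F) < card (\<Union>(N ` insert x X) \<inter> F)" using X by simp
  then have "\<not> \<Union>(N ` insert x X) \<inter> F \<subseteq> \<Union>(N ` X) \<inter> F" using fin by (meson card_mono finite_Int leD)
  then obtain y where y: "y \<in> N x" "y \<in> F" "y \<notin> \<Union>(N ` X)" by auto
  have "sum (f(x := f x - 1)) Y \<le> card (\<Union>(N ` Y) \<inter> (F - {y}))"
    if Y: "Y \<subseteq> L" "card Y \<le> 2 * K" for Y
  proof (cases "x \<in> Y")
    case True
    have finY: "finite Y" using Y fin by (rule_tac finite_subset)
    have "sum (f(x := f x - 1)) Y = (f x - 1) + sum f (Y - {x})"
      using True finY by (simp add: sum.remove)
    also have "\<dots> < sum f Y" using True finY x by (simp add: sum.remove[of Y x f])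
    also have "\<dots> \<le> card (\<Union>(N ` Y) \<inter> F)" using ext Y unfolding extendable_def by blast
    also have "\<dots> \<le> Suc (card (\<Union>(N ` Y) \<inter> (F - {y})))"
    proof -
      have "\<Union>(N ` Y) \<inter> F \<subseteq> insert y (\<Union>(N ` Y) \<inter> (F - {y}))" by auto
      then have "card (\<Union>(N ` Y) \<inter> F) \<le> card (insert y (\<Union>(N ` Y) \<inter> (F - {y})))"
        using fin by (intro card_mono) auto
      then show ?thesis using fin by (simp add: card_insert_if split: if_splits)
    qed
    finally show ?thesis by simp
  next
    case False
    then have eq: "sum (f(x := f x - 1)) Y = sum f Y" by (intro sum.cong) auto
    show ?thesis
    proof (cases "y \<in> \<Union>(N ` Y)")
      case False
      then have "\<Union>(N ` Y) \<inter> (F - {y}) = \<Union>(N ` Y) \<inter> F" by auto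
      then show ?thesis using ext Y eq unfolding extendable_def by auto
    next
      case True
      have "Y \<subseteq> L - {x}" using Y False by auto
      then have "card (\<Union>(N ` Y) \<inter> F) \<noteq> sum f Y" using max[rule_format, of Y] Y True y by blast
      then have "sum f Y < card (\<Union>(N ` Y) \<inter> F)"
        using ext[unfolded extendable_def, rule_format, of Y] Y by linarith
      moreover have "\<Union>(N ` Y) \<inter> (F - {y}) = (\<Union>(N ` Y) \<inter> F) - {y}" by auto
      ultimately show ?thesis using True y fin eq by (simp add: card_Diff_singleton)
    qed
  qed
  then show ?thesis using that y unfolding extendable_def by auto
qed

text \<open>A forest is encoded as a set of pairs (left vertex, claimed child). Injectivity of
  \<open>snd\<close> then says that no vertex is claimed twice.\<close>

abbreviation outdeg :: "('x \<times> 'b) set \<Rightarrow> 'x \<Rightarrow> nat" where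
  "outdeg T x \<equiv> card {e \<in> T. fst e = x}"

text \<open>Giving back a pair \<open>(x, y)\<close> raises the demand of a set by one exactly when
  the set contains \<open>x\<close>, and such a set regains the neighbour \<open>y\<close>. No slack
  is consumed, so any part of a forest can be returned.\<close>

lemma extendable_restore:
  assumes "finite T" "extendable N L K f F" "finite F" "finite L"
    "inj_on snd T" "snd ` T \<inter> F = {}" "\<And>e. e \<in> T \<Longrightarrow> snd e \<in> N (fst e)"
  shows "extendable N L K (\<lambda>x. f x + outdeg T x) (F \<union> snd ` T)"
  using assms
proof (induction T rule: finite_induct)
  case empty
  then show ?case by simp
next
  case (insert e T)
  obtain x y where e: "e = (x, y)" by force
  let ?g = "\<lambda>x. f x + outdeg T x" and ?G = "F \<union> snd ` T"
  have ext: "extendable N L K ?g ?G" using insert by auto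
  have y: "y \<notin> ?G" "y \<in> N x" using insert e by (auto simp: image_iff)
  have finG: "finite ?G" using insert by auto
  have deg: "outdeg (insert e T) z = outdeg T z + (if z = x then 1 else 0)" for z
  proof (cases "z = x")
    case True
    then have "{a \<in> insert e T. fst a = z} = insert e {a \<in> T. fst a = z}" using e by auto
    then show ?thesis using True insert by simp
  next
    case False
    then have "{a \<in> insert e T. fst a = z} = {a \<in> T. fst a = z}" using e by auto
    then show ?thesis using False by simp
  qed
  have "sum (\<lambda>x. f x + outdeg (insert e T) x) X \<le> card (\<Union>(N ` X) \<inter> (F \<union> snd ` insert e T))"
    if X: "X \<subseteq> L" "card X \<le> K" for X
  proof -
    have finX: "finite X" using X insert by (meson finite_subset)
    have "sum (\<lambda>x. f x + outdeg (insert e T) x) X = sum ?g X + sum (\<lambda>z. if z = x then 1 else 0) X"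
      unfolding deg by (simp add: sum.distrib add.assoc)
    also have "\<dots> = sum ?g X + (if x \<in> X then 1 else 0)" using finX by simp
    also have "\<dots> \<le> card (\<Union>(N ` X) \<inter> ?G) + (if x \<in> X then 1 else 0)"
      using ext X unfolding extendable_def by auto
    also have "\<dots> \<le> card (\<Union>(N ` X) \<inter> (F \<union> snd ` insert e T))"
    proof (cases "x \<in> X")
      case True
      then have "\<Union>(N ` X) \<inter> (F \<union> snd ` insert e T) = insert y (\<Union>(N ` X) \<inter> ?G)"
        using y e by auto
      then show ?thesis using True y finG by simp
    next
      case False
      then show ?thesis using insert by (auto intro!: card_mono)
    qed
    finally show ?thesis .
  qed
  then show ?case unfolding extendable_def by auto
qed

section \<open>Growing forests\<close>

definition nb :: "('a, 'b) pre_digraph \<Rightarrow> 'a set \<Rightarrow> 'a \<times> dirn \<Rightarrow> 'a set" where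
  "nb D A = (\<lambda>(v, s). {w \<in> A. is_nbr D s v w})"

text \<open>The edges of a path from a root \<open>p\<close> in the format of a forest: every parent
  carries the sign \<open>s\<close>. For \<open>Minus\<close> the arcs of the digraph point from
  child to parent, so the path is traversed backwards.\<close>

fun path_edges :: "dirn \<Rightarrow> 'a \<Rightarrow> 'a list \<Rightarrow> (('a \<times> dirn) \<times> 'a) set" where
  "path_edges s p [] = {}"
| "path_edges s p (y # ys) = insert ((p, s), y) (path_edges s y ys)"

lemma snd_path_edges: "snd ` path_edges s p ys = set ys"
  by (induction ys arbitrary: p) auto

lemma fst_path_edges: "fst ` path_edges s p ys \<subseteq> insert p (set ys) \<times> {s}"
proof (induction ys arbitrary: p)
  case (Cons y ys)
  then show ?case using Cons[of y] by auto
qed simp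

lemma successively_path_edges_Plus:
  assumes "path_edges Plus p ys \<subseteq> T" "\<forall>e\<in>T. snd e \<in> nb D A (fst e)"
  shows "successively (\<lambda>u v. u \<rightarrow>\<^bsub>D\<^esub> v) (p # ys)"
  using assms by (induction ys arbitrary: p) (auto simp: nb_def)

lemma successively_path_edges_Minus:
  assumes "path_edges Minus p ys \<subseteq> T" "\<forall>e\<in>T. snd e \<in> nb D A (fst e)"
  shows "successively (\<lambda>u v. u \<rightarrow>\<^bsub>D\<^esub> v) (rev (p # ys))"
  using assms
  by (induction ys arbitrary: p) (auto simp: nb_def successively_append_iff)

lemma count_list_distinct: "distinct xs \<Longrightarrow> count_list xs x \<le> 1"
  by (induction xs) auto

lemma outdeg_Un:
  assumes "finite T1" "finite T2" "T1 \<inter> T2 = {}"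
  shows "outdeg (T1 \<union> T2) x = outdeg T1 x + outdeg T2 x"
proof -
  have "{e \<in> T1 \<union> T2. fst e = x} = {e \<in> T1. fst e = x} \<union> {e \<in> T2. fst e = x}" by auto
  then show ?thesis using assms by (simp add: card_Un_disjoint disjoint_iff)
qed

lemma outdeg_eq_0: "x \<notin> fst ` T \<Longrightarrow> outdeg T x = 0"
  by (metis (mono_tags, lifting) Collect_empty_eq card.empty image_eqI)

text \<open>Two children per vertex make binary trees. \<open>P\<close> holds the ends of the
  current paths, which grow only out-trees, and \<open>Q\<close> their starts, which grow only
  in-trees. A free vertex may become an inner vertex of a tree of either kind and therefore keeps
  its demand for both signs.\<close>

definition demand :: "'a set \<Rightarrow> 'a set \<Rightarrow> 'a set \<Rightarrow> 'a \<times> dirn \<Rightarrow> nat" where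
  "demand P Q F = (\<lambda>(v, s). if v \<in> F \<or> s = Plus \<and> v \<in> P \<or> s = Minus \<and> v \<in> Q then 2 else 0)"

text \<open>The setting abstracts from the theorem: \<open>W\<close> is the union of the two given
  sets, \<open>\<mu>\<close> is m rounded up, and \<open>big\<close> is condition (ii) for all sets
  of size at least \<open>\<mu>\<close>, with neighbours inside the set counted as well.\<close>

locale expanding =
  fixes D :: "('a, 'b) pre_digraph" and A W :: "'a set" and \<mu> :: nat and \<eta> :: real
  assumes finite_W: "finite W" and A_subset: "A \<subseteq> W" and mu_pos: "\<mu> > 0" and eta_le: "\<eta> \<le> 1 / 2"
    and big: "\<And>s X. X \<subseteq> W \<Longrightarrow> \<mu> \<le> card X \<Longrightarrow>
      (1 / 2 + \<eta>) * real (card A) \<le> real (card (\<Union>v\<in>X. nb D A (v, s)))"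
begin

text \<open>The size threshold for left vertices is \<open>2 * \<mu>\<close> rather than
  \<open>\<mu>\<close>: among that many pairs (vertex, sign), one sign occurs with at least
  \<open>\<mu>\<close> vertices. The outer factor 2 leaves room for unions of two tight
  sets.\<close>

abbreviation ext :: "('a \<times> dirn \<Rightarrow> nat) \<Rightarrow> 'a set \<Rightarrow> bool" where
  "ext \<equiv> extendable (nb D A) (W \<times> UNIV) (2 * (2 * \<mu>))"

lemma finite_A: "finite A"
  using finite_W A_subset by (rule_tac finite_subset)

lemma finite_UNIV_dirn: "finite (UNIV :: dirn set)"
proof -
  have "(UNIV :: dirn set) \<subseteq> {Plus, Minus}" using dirn.exhaust by blast
  then show ?thesis by (rule finite_subset) simp
qed

lemma finite_L: "finite (W \<times> (UNIV :: dirn set))"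
  using finite_W finite_UNIV_dirn by simp

lemma nb_subset: "nb D A x \<subseteq> A"
  by (auto simp: nb_def)

lemma card_split:
  fixes X :: "('a \<times> dirn) set"
  assumes "finite X"
  shows "card X = card {v. (v, Plus) \<in> X} + card {v. (v, Minus) \<in> X}"
proof -
  have eq: "X = (\<lambda>v. (v, Plus)) ` {v. (v, Plus) \<in> X} \<union> (\<lambda>v. (v, Minus)) ` {v. (v, Minus) \<in> X}"
    (is "X = ?P \<union> ?M")
  proof (intro set_eqI iffI)
    fix x assume "x \<in> X"
    then show "x \<in> ?P \<union> ?M" by (cases x, cases "snd x") auto
  qed auto
  have "card X = card ?P + card ?M"
    using assms eq by (subst eq, intro card_Un_disjoint) (auto intro: finite_subset)
  then show ?thesis by (simp add: card_image inj_on_def)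
qed

text \<open>This supplies the hypothesis \<open>big\<close> of the extension lemmas. One sign
  contributes \<open>\<mu>\<close> vertices, whose neighbourhood covers more than half of
  \<open>A\<close>; after the used vertices are discarded, more than \<open>8 * \<mu>\<close>
  remain, while at most \<open>4 * \<mu>\<close> left vertices demand at most 2 each.\<close>

lemma large_sets:
  assumes F: "F \<subseteq> A" and room: "real (card (A - F)) + 8 * real \<mu> < (1 / 2 + \<eta>) * real (card A)"
    and f: "\<forall>x\<in>W \<times> UNIV. f x \<le> 2"
  shows "\<forall>X\<subseteq>W \<times> UNIV. 2 * \<mu> \<le> card X \<and> card X \<le> 2 * (2 * \<mu>) \<longrightarrow>
    sum f X < card (\<Union>(nb D A ` X) \<inter> F)"
proof (intro allI impI, elim conjE)
  fix X :: "('a \<times> dirn) set" assume X: "X \<subseteq> W \<times> UNIV" "2 * \<mu> \<le> card X" "card X \<le> 2 * (2 * \<mu>)"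
  have finX: "finite X" using X finite_L by (rule_tac finite_subset)
  obtain s where s: "\<mu> \<le> card {v. (v, s) \<in> X}"
    using card_split[OF finX] X by (metis add_less_mono leI mult_2 not_le)
  have "(1 / 2 + \<eta>) * real (card A) \<le> real (card (\<Union>v\<in>{v. (v, s) \<in> X}. nb D A (v, s)))"
    using X by (intro big s) auto
  also have "\<dots> \<le> real (card (\<Union>(nb D A ` X)))"
  proof -
    have "\<Union>(nb D A ` X) \<subseteq> A" using nb_subset by blast
    then show ?thesis using finite_A by (auto intro!: card_mono intro: finite_subset)
  qed
  also have "\<dots> \<le> real (card (\<Union>(nb D A ` X) \<inter> F) + card (A - F))"
  proof -
    have "\<Union>(nb D A ` X) \<subseteq> (\<Union>(nb D A ` X) \<inter> F) \<union> (A - F)" using nb_subset by blast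
    then have "card (\<Union>(nb D A ` X)) \<le> card ((\<Union>(nb D A ` X) \<inter> F) \<union> (A - F))"
      using finite_A F by (intro card_mono) (auto intro: finite_subset)
    also have "\<dots> \<le> card (\<Union>(nb D A ` X) \<inter> F) + card (A - F)" by (rule card_Un_le)
    finally show ?thesis by simp
  qed
  finally have "8 * real \<mu> < real (card (\<Union>(nb D A ` X) \<inter> F))" using room by simp
  moreover have "sum f X \<le> card X * 2"
    using f X by (intro sum_bounded_above[of X f 2, simplified]) auto
  ultimately show "sum f X < card (\<Union>(nb D A ` X) \<inter> F)" using X by linarith
qed

text \<open>Each list entry claims one child by \<open>extendable_extend\<close>, and an entry may
  be repeated as often as its demand allows. A step adds one used vertex and shortens the list by
  one, so the room hypothesis is preserved. The two bounds on \<open>g'\<close> record that demand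
  is lost only against claimed children.\<close>

lemma grow_list:
  assumes "ext g F" "F \<subseteq> A" "set xs \<subseteq> W \<times> UNIV" "\<forall>x. count_list xs x \<le> g x"
    "\<forall>x\<in>W \<times> UNIV. g x \<le> 2"
    "real (card (A - F)) + real (length xs) + 8 * real \<mu> < (1 / 2 + \<eta>) * real (card A)"
  shows "\<exists>T g'. finite T \<and> inj_on snd T \<and> snd ` T \<subseteq> F \<and> (\<forall>e\<in>T. snd e \<in> nb D A (fst e)) \<and>
    fst ` T \<subseteq> set xs \<and> card T = length xs \<and> ext g' (F - snd ` T) \<and>
    (\<forall>x. g x \<le> g' x + outdeg T x) \<and> (\<forall>x. g' x \<le> g x)"
  using assms
proof (induction xs arbitrary: g F)
  case Nil
  then show ?case by (intro exI[of _ "{}"] exI[of _ g]) auto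
next
  case (Cons x xs)
  have finF: "finite F" using Cons.prems(2) finite_A by (rule finite_subset)
  have "real (card (A - F)) + 8 * real \<mu> < (1 / 2 + \<eta>) * real (card A)" using Cons.prems(6) by simp
  note large = large_sets[OF Cons.prems(2) this Cons.prems(5)]
  have gx: "g x > 0" using Cons.prems(4)[rule_format, of x] by simp
  obtain y where y: "y \<in> nb D A x" "y \<in> F" "ext (g(x := g x - 1)) (F - {y})"
    using extendable_extend[OF Cons.prems(1) finite_L finF _ large _ gx] mu_pos Cons.prems(3) by auto
  let ?g = "g(x := g x - 1)"
  have cy: "card (A - (F - {y})) = Suc (card (A - F))"
  proof -
    have "A - (F - {y}) = insert y (A - F)" using y Cons.prems(2) by auto
    then show ?thesis using y finite_A by simp
  qed
  have "\<exists>T g'. finite T \<and> inj_on snd T \<and> snd ` T \<subseteq> F - {y} \<and> (\<forall>e\<in>T. snd e \<in> nb D A (fst e)) \<and>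
    fst ` T \<subseteq> set xs \<and> card T = length xs \<and> ext g' (F - {y} - snd ` T) \<and>
    (\<forall>x. ?g x \<le> g' x + outdeg T x) \<and> (\<forall>x. g' x \<le> ?g x)"
  proof (rule Cons.IH[OF y(3)])
    show "\<forall>z. count_list xs z \<le> ?g z"
    proof
      fix z
      show "count_list xs z \<le> ?g z"
        using Cons.prems(4)[rule_format, of z] by (cases "z = x") auto
    qed
    show "\<forall>x\<in>W \<times> UNIV. ?g x \<le> 2" using Cons.prems(5) by (auto intro: order_trans[OF diff_le_self])
  qed (use Cons.prems cy in auto)
  then obtain T g' where T: "finite T" "inj_on snd T" "snd ` T \<subseteq> F - {y}"
    "\<forall>e\<in>T. snd e \<in> nb D A (fst e)" "fst ` T \<subseteq> set xs" "card T = length xs"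
    "ext g' (F - {y} - snd ` T)" "\<forall>x. ?g x \<le> g' x + outdeg T x" "\<forall>x. g' x \<le> ?g x" by blast
  let ?T = "insert (x, y) T"
  have new: "(x, y) \<notin> T" "y \<notin> snd ` T" using T(3) by (auto simp: image_iff)
  have "outdeg ?T z = outdeg {(x, y)} z + outdeg T z" for z
    using outdeg_Un[of "{(x, y)}" T z] T(1) new by simp
  moreover have "outdeg {(x, y)} x = 1"
  proof -
    have "{e \<in> {(x, y)}. fst e = x} = {(x, y)}" by auto
    then show ?thesis by simp
  qed
  ultimately have deg: "g z \<le> g' z + outdeg ?T z" for z
    using T(8)[rule_format, of z] by (cases "z = x") (auto simp: le_diff_conv)
  have "F - snd ` ?T = F - {y} - snd ` T" by auto
  then have "ext g' (F - snd ` ?T)" using T by simp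
  moreover have "inj_on snd ?T" using T new by (auto simp: inj_on_insert image_iff)
  moreover have "g' z \<le> g z" for z using T(9)[rule_format, of z] by (cases "z = x") auto
  ultimately show ?case
    using T new y deg by (intro exI[of _ ?T] exI[of _ g']) auto
qed

text \<open>The forest grows level by level: the roots claim two children each, and these are the
  roots for the remaining depth. The levels have 2, 4, ..., \<open>2 ^ k\<close> vertices per root,
  which gives the edge count; it is stated without subtraction on naturals. \<open>Q\<close> is the
  set of leaves.\<close>

lemma grow_forest:
  assumes "ext g F" "F \<subseteq> A" "R \<subseteq> W" "R \<inter> F = {}" "\<forall>v\<in>R \<union> F. 2 \<le> g (v, s)"
    "\<forall>x\<in>W \<times> UNIV. g x \<le> 2"
    "real (card (A - F)) + (2 ^ (k + 1) * real (card R) - 2 * real (card R)) + 8 * real \<mu>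
      < (1 / 2 + \<eta>) * real (card A)"
  shows "\<exists>T g' Q. finite T \<and> inj_on snd T \<and> snd ` T \<subseteq> F \<and> (\<forall>e\<in>T. snd e \<in> nb D A (fst e)) \<and>
    fst ` T \<subseteq> (R \<union> F) \<times> {s} \<and> card T + 2 * card R = 2 ^ (k + 1) * card R \<and>
    ext g' (F - snd ` T) \<and> (\<forall>x. g x \<le> g' x + outdeg T x) \<and> (\<forall>x. g' x \<le> g x) \<and>
    Q \<subseteq> R \<union> F \<and> card Q = 2 ^ k * card R \<and>
    (\<forall>u\<in>Q. \<exists>p\<in>R. \<exists>ys. length ys = k \<and> distinct ys \<and> path_edges s p ys \<subseteq> T \<and> last (p # ys) = u)"
  using assms
proof (induction k arbitrary: g F R)
  case 0
  then show ?case
    by (intro exI[of _ "{}"] exI[of _ g] exI[of _ R]) auto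
next
  case (Suc k)
  have finR: "finite R" using Suc.prems(3) finite_W by (rule finite_subset)
  obtain rs where rs: "set rs = R" "distinct rs" using finite_distinct_list[OF finR] by auto
  have lrs: "length rs = card R" using rs distinct_card by metis
  \<comment> \<open>Listing every root twice makes it claim two children.\<close>
  define xs where "xs = map (\<lambda>v. (v, s)) (rs @ rs)"
  have "\<exists>T g'. finite T \<and> inj_on snd T \<and> snd ` T \<subseteq> F \<and> (\<forall>e\<in>T. snd e \<in> nb D A (fst e)) \<and>
    fst ` T \<subseteq> set xs \<and> card T = length xs \<and> ext g' (F - snd ` T) \<and>
    (\<forall>x. g x \<le> g' x + outdeg T x) \<and> (\<forall>x. g' x \<le> g x)"
  proof (rule grow_list[OF Suc.prems(1,2)])
    show "set xs \<subseteq> W \<times> UNIV" using Suc.prems(3) rs unfolding xs_def by auto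
    show "\<forall>x. count_list xs x \<le> g x"
    proof
      fix x
      have inj: "distinct (map (\<lambda>v. (v, s)) rs)" using rs by (simp add: distinct_map inj_on_def)
      have "count_list xs x = 2 * count_list (map (\<lambda>v. (v, s)) rs) x" unfolding xs_def by simp
      also have "\<dots> \<le> (if x \<in> R \<times> {s} then 2 else 0)"
      proof (cases "x \<in> R \<times> {s}")
        case True
        then show ?thesis using count_list_distinct[OF inj, of x] by simp
      next
        case False
        then have "x \<notin> set (map (\<lambda>v. (v, s)) rs)" using rs by auto
        then have "count_list (map (\<lambda>v. (v, s)) rs) x = 0" by (rule count_notin)
        then show ?thesis by (simp only: mult_0_right le0)
      qed
      also have "\<dots> \<le> g x" using Suc.prems(5) by auto
      finally show "count_list xs x \<le> g x" .
    qed
    \<comment> \<open>The first level takes \<open>2 * card R\<close> vertices, which must fit into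
      the allowance for the whole forest.\<close>
    have "(2::real) ^ (Suc k + 1) \<ge> 4"
      using power_increasing[of 2 "Suc k + 1" "2::real"] by simp
    then have "(2::real) ^ (Suc k + 1) * real (card R) \<ge> 4 * real (card R)"
      by (intro mult_right_mono) auto
    then show "real (card (A - F)) + real (length xs) + 8 * real \<mu> < (1 / 2 + \<eta>) * real (card A)"
      using Suc.prems(7) lrs unfolding xs_def by simp
  qed (rule Suc.prems(6))
  then obtain T1 g1 where T1: "finite T1" "inj_on snd T1" "snd ` T1 \<subseteq> F"
    "\<forall>e\<in>T1. snd e \<in> nb D A (fst e)" "fst ` T1 \<subseteq> set xs" "card T1 = length xs"
    "ext g1 (F - snd ` T1)" "\<forall>x. g x \<le> g1 x + outdeg T1 x" "\<forall>x. g1 x \<le> g x" by blast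
  have fstT1: "fst ` T1 \<subseteq> R \<times> {s}" using T1(5) rs unfolding xs_def by auto
  define R1 where "R1 = snd ` T1"
  define F1 where "F1 = F - R1"
  have R1: "R1 \<subseteq> F" "card R1 = 2 * card R"
    using T1 lrs card_image[of snd T1] unfolding R1_def xs_def by auto
  have cF1: "card (A - F1) = card (A - F) + 2 * card R"
  proof -
    have "A - F1 = (A - F) \<union> R1" using R1 Suc.prems(2) unfolding F1_def by auto
    moreover have "(A - F) \<inter> R1 = {}" using R1 by auto
    moreover have "finite R1" using T1 unfolding R1_def by simp
    ultimately show ?thesis using finite_A R1 by (simp add: card_Un_disjoint)
  qed
  have "\<exists>T g' Q. finite T \<and> inj_on snd T \<and> snd ` T \<subseteq> F1 \<and> (\<forall>e\<in>T. snd e \<in> nb D A (fst e)) \<and>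
    fst ` T \<subseteq> (R1 \<union> F1) \<times> {s} \<and> card T + 2 * card R1 = 2 ^ (k + 1) * card R1 \<and>
    ext g' (F1 - snd ` T) \<and> (\<forall>x. g1 x \<le> g' x + outdeg T x) \<and> (\<forall>x. g' x \<le> g1 x) \<and>
    Q \<subseteq> R1 \<union> F1 \<and> card Q = 2 ^ k * card R1 \<and>
    (\<forall>u\<in>Q. \<exists>p\<in>R1. \<exists>ys. length ys = k \<and> distinct ys \<and> path_edges s p ys \<subseteq> T \<and> last (p # ys) = u)"
  proof (rule Suc.IH)
    show "ext g1 F1" using T1 unfolding F1_def R1_def by simp
    show "F1 \<subseteq> A" "R1 \<subseteq> W" using Suc.prems(2) A_subset R1 unfolding F1_def by auto
    show "R1 \<inter> F1 = {}" unfolding F1_def by auto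
    \<comment> \<open>The parents so far lie in \<open>R\<close>, which is disjoint from
      \<open>F\<close>; hence the new roots and the vertices still free have spent nothing.\<close>
    show "\<forall>v\<in>R1 \<union> F1. 2 \<le> g1 (v, s)"
    proof
      fix v assume "v \<in> R1 \<union> F1"
      then have v: "v \<in> F" using R1 F1_def by auto
      then have "(v, s) \<notin> fst ` T1" using fstT1 Suc.prems(4) by auto
      then have "outdeg T1 (v, s) = 0" by (rule outdeg_eq_0)
      then show "2 \<le> g1 (v, s)" using T1(8)[rule_format, of "(v, s)"] Suc.prems(5) v by force
    qed
    show "\<forall>x\<in>W \<times> UNIV. g1 x \<le> 2" using T1(9) Suc.prems(6) order_trans by blast
    show "real (card (A - F1)) + (2 ^ (k + 1) * real (card R1) - 2 * real (card R1)) + 8 * real \<mu>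
      < (1 / 2 + \<eta>) * real (card A)" using Suc.prems(7) cF1 R1 by simp
  qed
  then obtain T2 g2 Q where T2: "finite T2" "inj_on snd T2" "snd ` T2 \<subseteq> F1"
    "\<forall>e\<in>T2. snd e \<in> nb D A (fst e)" "fst ` T2 \<subseteq> (R1 \<union> F1) \<times> {s}"
    "card T2 + 2 * card R1 = 2 ^ (k + 1) * card R1"
    "ext g2 (F1 - snd ` T2)" "\<forall>x. g1 x \<le> g2 x + outdeg T2 x" "\<forall>x. g2 x \<le> g1 x"
    and Q: "Q \<subseteq> R1 \<union> F1" "card Q = 2 ^ k * card R1"
    "\<forall>u\<in>Q. \<exists>p\<in>R1. \<exists>ys. length ys = k \<and> distinct ys \<and> path_edges s p ys \<subseteq> T2 \<and> last (p # ys) = u"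
    by blast
  have sd: "snd ` T1 \<inter> snd ` T2 = {}" using T2(3) unfolding F1_def R1_def by auto
  have dj: "T1 \<inter> T2 = {}" using sd by auto
  let ?T = "T1 \<union> T2"
  have "inj_on snd ?T" using T1(2) T2(2) sd by (auto simp: inj_on_Un)
  moreover have "snd ` ?T \<subseteq> F" using T1(3) T2(3) unfolding F1_def by auto
  moreover have "fst ` ?T \<subseteq> (R \<union> F) \<times> {s}"
  proof -
    have "(R1 \<union> F1) \<times> {s} \<subseteq> (R \<union> F) \<times> {s}" "R \<times> {s} \<subseteq> (R \<union> F) \<times> {s}"
      using R1(1) unfolding F1_def by auto
    then show ?thesis unfolding image_Un by (intro Un_least order_trans[OF fstT1] order_trans[OF T2(5)])
  qed
  moreover have "card ?T + 2 * card R = 2 ^ (Suc k + 1) * card R"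
    using T1(1,6) T2(1,6) dj R1 lrs unfolding xs_def by (simp add: card_Un_disjoint)
  moreover have "ext g2 (F - snd ` ?T)"
  proof -
    have "F - snd ` ?T = F1 - snd ` T2" unfolding F1_def R1_def by auto
    then show ?thesis using T2(7) by simp
  qed
  moreover have "g x \<le> g2 x + outdeg ?T x" for x
    using T1(8)[rule_format, of x] T2(8)[rule_format, of x] outdeg_Un[OF T1(1) T2(1) dj, of x] by linarith
  moreover have "g2 x \<le> g x" for x using T1(9) T2(9) order_trans by blast
  moreover have "Q \<subseteq> R \<union> F" using Q R1 unfolding F1_def by auto
  moreover have "card Q = 2 ^ Suc k * card R" using Q R1 by simp
  moreover have "\<exists>p\<in>R. \<exists>ys. length ys = Suc k \<and> distinct ys \<and> path_edges s p ys \<subseteq> ?T \<and> last (p # ys) = u"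
    if u: "u \<in> Q" for u
  proof -
    obtain y ys where y: "y \<in> R1" "length ys = k" "distinct ys" "path_edges s y ys \<subseteq> T2" "last (y # ys) = u"
      using Q(3) u by blast
    obtain x where x: "(x, y) \<in> T1" using y(1) unfolding R1_def by auto
    then obtain p where p: "p \<in> R" "x = (p, s)" using fstT1 by force
    have "set ys \<subseteq> F1" using image_mono[OF y(4), of snd] T2(3) snd_path_edges[of s y ys] by simp
    then have "y \<notin> set ys" using y(1) unfolding F1_def by auto
    then show ?thesis using p x y by (intro bexI[of _ p] exI[of _ "y # ys"]) auto
  qed
  moreover have "finite ?T" "\<forall>e\<in>?T. snd e \<in> nb D A (fst e)" using T1(1,4) T2(1,4) by auto
  ultimately show ?case by (intro exI[of _ ?T] exI[of _ g2] exI[of _ Q]) simp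
qed

end

section \<open>Connecting an end to a start\<close>

context expanding
begin

lemma demand_le: "demand P Q F x \<le> 2"
  by (cases x) (simp add: demand_def)

text \<open>Each forest uses at most \<open>4 * \<mu>\<close> vertices and has at least
  \<open>\<mu>\<close> leaves, so the leaf neighbourhoods overlap in many free vertices. Any overlap
  vertex \<open>z\<close> joins a leaf of each forest; \<open>extendable_remove\<close> picks one
  that can be spared. Returning all tree edges off the resulting path restores full demand
  everywhere else, which makes the lemma iterable.\<close>

lemma connect:
  assumes ext: "ext (demand P Q F) F" and F: "F \<subseteq> A"
    and P: "P \<subseteq> W" "P \<inter> F = {}" and Q: "Q \<subseteq> W" "Q \<inter> F = {}"
    and P0: "P0 \<subseteq> P" "card P0 = r" and Q0: "Q0 \<subseteq> Q" "card Q0 = r"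
    and k: "\<mu> \<le> 2 ^ k * r" "k = 0 \<or> 2 ^ k * r \<le> 2 * \<mu>"
    and room: "real (card (A - F)) + 20 * real \<mu> < \<eta> * real (card A)"
  shows "\<exists>p\<in>P0. \<exists>q\<in>Q0. \<exists>ys. length ys = 2 * k + 1 \<and> distinct ys \<and> set ys \<subseteq> F \<and>
    successively (\<lambda>u v. u \<rightarrow>\<^bsub>D\<^esub> v) (p # ys @ [q]) \<and>
    ext (demand (P - {p}) (Q - {q}) (F - set ys)) (F - set ys)"
proof -
  let ?d = "demand P Q F"
  \<comment> \<open>For \<open>k = 0\<close> the forest has no edges; otherwise the minimality
    expressed by \<open>k(2)\<close> bounds its size.\<close>
  have grow: "2 ^ (k + 1) * real r - 2 * real r \<le> 4 * real \<mu>"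
    using k(2)
  proof
    assume "2 ^ k * r \<le> 2 * \<mu>"
    then have "real (2 ^ k * r) \<le> real (2 * \<mu>)" by (simp only: of_nat_le_iff)
    then show ?thesis by simp
  qed simp
  have half: "\<eta> * real (card A) \<le> (1 / 2) * real (card A)"
    using eta_le by (intro mult_right_mono) auto
  have nn: "0 \<le> real (card (A - F))" by simp
  have pos: "real \<mu> > 0" using mu_pos by simp
  have split: "(1 / 2 + \<eta>) * real (card A) = (1 / 2) * real (card A) + \<eta> * real (card A)"
    by (simp add: algebra_simps)
  have "\<exists>T g' L. finite T \<and> inj_on snd T \<and> snd ` T \<subseteq> F \<and> (\<forall>e\<in>T. snd e \<in> nb D A (fst e)) \<and>
    fst ` T \<subseteq> (P0 \<union> F) \<times> {Plus} \<and> card T + 2 * card P0 = 2 ^ (k + 1) * card P0 \<and>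
    ext g' (F - snd ` T) \<and> (\<forall>x. ?d x \<le> g' x + outdeg T x) \<and> (\<forall>x. g' x \<le> ?d x) \<and>
    L \<subseteq> P0 \<union> F \<and> card L = 2 ^ k * card P0 \<and>
    (\<forall>u\<in>L. \<exists>p\<in>P0. \<exists>ys. length ys = k \<and> distinct ys \<and> path_edges Plus p ys \<subseteq> T \<and> last (p # ys) = u)"
  proof (rule grow_forest[OF ext F])
    show "real (card (A - F)) + (2 ^ (k + 1) * real (card P0) - 2 * real (card P0)) + 8 * real \<mu>
      < (1 / 2 + \<eta>) * real (card A)" using room grow half pos nn unfolding split P0(2) by linarith
    show "\<forall>v\<in>P0 \<union> F. 2 \<le> demand P Q F (v, Plus)" using P0 by (auto simp: demand_def)
  qed (use P P0 demand_le in auto)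
  then obtain T1 g1 L1 where T1: "finite T1" "inj_on snd T1" "snd ` T1 \<subseteq> F"
    "\<forall>e\<in>T1. snd e \<in> nb D A (fst e)" "fst ` T1 \<subseteq> (P0 \<union> F) \<times> {Plus}"
    "card T1 + 2 * card P0 = 2 ^ (k + 1) * card P0"
    "ext g1 (F - snd ` T1)" "\<forall>x. ?d x \<le> g1 x + outdeg T1 x" "\<forall>x. g1 x \<le> ?d x"
    and L1: "L1 \<subseteq> P0 \<union> F" "card L1 = 2 ^ k * card P0"
    "\<forall>u\<in>L1. \<exists>p\<in>P0. \<exists>ys. length ys = k \<and> distinct ys \<and> path_edges Plus p ys \<subseteq> T1 \<and> last (p # ys) = u"
    by blast
  have cT1: "real (card T1) \<le> 4 * real \<mu>"
  proof -
    have "real (card T1 + 2 * card P0) = real (2 ^ (k + 1) * card P0)" using T1(6) by simp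
    then have "real (card T1) = 2 ^ (k + 1) * real r - 2 * real r" using P0 by simp
    then show ?thesis using grow by simp
  qed
  define F1 where "F1 = F - snd ` T1"
  have F1: "F1 \<subseteq> A" "F1 \<subseteq> F" using F unfolding F1_def by auto
  have cF1: "real (card (A - F1)) \<le> real (card (A - F)) + 4 * real \<mu>"
  proof -
    have "card (A - F1) \<le> card ((A - F) \<union> snd ` T1)"
      using finite_A T1(1) unfolding F1_def by (intro card_mono) auto
    also have "\<dots> \<le> card (A - F) + card T1"
      using card_Un_le[of "A - F" "snd ` T1"] card_image_le[OF T1(1), of snd] by linarith
    finally show ?thesis using cT1 by linarith
  qed
  have "\<exists>T g' L. finite T \<and> inj_on snd T \<and> snd ` T \<subseteq> F1 \<and> (\<forall>e\<in>T. snd e \<in> nb D A (fst e)) \<and>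
    fst ` T \<subseteq> (Q0 \<union> F1) \<times> {Minus} \<and> card T + 2 * card Q0 = 2 ^ (k + 1) * card Q0 \<and>
    ext g' (F1 - snd ` T) \<and> (\<forall>x. g1 x \<le> g' x + outdeg T x) \<and> (\<forall>x. g' x \<le> g1 x) \<and>
    L \<subseteq> Q0 \<union> F1 \<and> card L = 2 ^ k * card Q0 \<and>
    (\<forall>u\<in>L. \<exists>p\<in>Q0. \<exists>ys. length ys = k \<and> distinct ys \<and> path_edges Minus p ys \<subseteq> T \<and> last (p # ys) = u)"
  proof (rule grow_forest)
    show "ext g1 F1" using T1 unfolding F1_def by simp
    show "real (card (A - F1)) + (2 ^ (k + 1) * real (card Q0) - 2 * real (card Q0)) + 8 * real \<mu>
      < (1 / 2 + \<eta>) * real (card A)" using room grow half pos nn cF1 unfolding split Q0(2) by linarith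
    \<comment> \<open>The out-forest spends demand at the sign \<open>Plus\<close> only.\<close>
    show "\<forall>v\<in>Q0 \<union> F1. 2 \<le> g1 (v, Minus)"
    proof
      fix v assume v: "v \<in> Q0 \<union> F1"
      have "(v, Minus) \<notin> fst ` T1" using T1(5) by auto
      then have "outdeg T1 (v, Minus) = 0" by (rule outdeg_eq_0)
      moreover have "?d (v, Minus) = 2" using v Q0 F1 by (auto simp: demand_def)
      ultimately show "2 \<le> g1 (v, Minus)" using T1(8)[rule_format, of "(v, Minus)"] by simp
    qed
    show "\<forall>x\<in>W \<times> UNIV. g1 x \<le> 2" using T1(9) demand_le order_trans by blast
  qed (use Q Q0 F1 in auto)
  then obtain T2 g2 L2 where T2: "finite T2" "inj_on snd T2" "snd ` T2 \<subseteq> F1"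
    "\<forall>e\<in>T2. snd e \<in> nb D A (fst e)" "fst ` T2 \<subseteq> (Q0 \<union> F1) \<times> {Minus}"
    "card T2 + 2 * card Q0 = 2 ^ (k + 1) * card Q0"
    "ext g2 (F1 - snd ` T2)" "\<forall>x. g1 x \<le> g2 x + outdeg T2 x" "\<forall>x. g2 x \<le> g1 x"
    and L2: "L2 \<subseteq> Q0 \<union> F1" "card L2 = 2 ^ k * card Q0"
    "\<forall>u\<in>L2. \<exists>p\<in>Q0. \<exists>ys. length ys = k \<and> distinct ys \<and> path_edges Minus p ys \<subseteq> T2 \<and> last (p # ys) = u"
    by blast
  have cT2: "real (card T2) \<le> 4 * real \<mu>"
  proof -
    have "real (card T2 + 2 * card Q0) = real (2 ^ (k + 1) * card Q0)" using T2(6) by simp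
    then have "real (card T2) = 2 ^ (k + 1) * real r - 2 * real r" using Q0 by simp
    then show ?thesis using grow by simp
  qed
  define F2 where "F2 = F1 - snd ` T2"
  have F2: "F2 \<subseteq> A" "F2 \<subseteq> F1" "finite F2" using F1 finite_A unfolding F2_def by (auto intro: finite_subset)
  have cF2: "real (card (A - F2)) \<le> real (card (A - F)) + 8 * real \<mu>"
  proof -
    have "card (A - F2) \<le> card ((A - F1) \<union> snd ` T2)"
      using finite_A T2(1) unfolding F2_def by (intro card_mono) auto
    also have "\<dots> \<le> card (A - F1) + card T2"
      using card_Un_le[of "A - F1" "snd ` T2"] card_image_le[OF T2(1), of snd] by linarith
    finally show ?thesis using cT2 cF1 by linarith
  qed
  define N1 where "N1 = (\<Union>v\<in>L1. nb D A (v, Plus))"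
  define N2 where "N2 = (\<Union>v\<in>L2. nb D A (v, Minus))"
  have N: "N1 \<subseteq> A" "N2 \<subseteq> A" unfolding N1_def N2_def using nb_subset by blast+
  have finN: "finite N1" "finite N2" using N finite_A by (auto intro: finite_subset)
  have "(1 / 2 + \<eta>) * real (card A) \<le> real (card N1)"
    unfolding N1_def by (rule big) (use L1(1,2) P0 P(1) F A_subset k(1) in blast, use L1(2) P0(2) k(1) in simp)
  moreover have "(1 / 2 + \<eta>) * real (card A) \<le> real (card N2)"
    unfolding N2_def by (rule big) (use L2(1,2) Q0 Q(1) F1 A_subset k(1) in blast, use L2(2) Q0(2) k(1) in simp)
  moreover have "card N1 + card N2 = card (N1 \<union> N2) + card (N1 \<inter> N2)"
    using finN by (rule card_Un_Int)
  moreover have "card (N1 \<union> N2) \<le> card A" using N finite_A by (intro card_mono) auto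
  \<comment> \<open>Two subsets of \<open>A\<close> that each exceed half of \<open>A\<close> by
    \<open>\<eta>\<close> times its size meet in at least twice that excess.\<close>
  ultimately have "2 * \<eta> * real (card A) \<le> real (card (N1 \<inter> N2))"
    unfolding split by linarith
  moreover have "card (N1 \<inter> N2) \<le> card (N1 \<inter> N2 \<inter> F2) + card (A - F2)"
  proof -
    have "card (N1 \<inter> N2) \<le> card ((N1 \<inter> N2 \<inter> F2) \<union> (A - F2))"
      using finite_A finN N by (intro card_mono) auto
    then show ?thesis using card_Un_le order_trans by blast
  qed
  moreover have "0 \<le> real (card (A - F))" by simp
  \<comment> \<open>The bound is the maximal demand 2 times the threshold \<open>2 * \<mu>\<close>,
    as \<open>extendable_remove\<close> requires.\<close>
  ultimately have Z: "2 * (2 * \<mu>) \<le> card (N1 \<inter> N2 \<inter> F2)"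
    using room cF2 pos by linarith
  have g2: "g2 x \<le> 2" for x
    using T1(9)[rule_format, of x] T2(9)[rule_format, of x] demand_le[of P Q F x] by linarith
  have ext2: "ext g2 F2" using T2 unfolding F2_def by simp
  have "real (card (A - F2)) + 8 * real \<mu> < (1 / 2 + \<eta>) * real (card A)"
    using room cF2 half pos nn unfolding split by linarith
  then have large: "\<forall>X\<subseteq>W \<times> UNIV. 2 * \<mu> \<le> card X \<and> card X \<le> 2 * (2 * \<mu>) \<longrightarrow>
      sum g2 X < card (\<Union>(nb D A ` X) \<inter> F2)"
    using g2 by (intro large_sets[OF F2(1)]) auto
  have mu2: "2 * \<mu> > 0" using mu_pos by simp
  have NF: "N1 \<inter> N2 \<inter> F2 \<subseteq> F2" by simp
  obtain z where z: "z \<in> N1 \<inter> N2 \<inter> F2" "ext g2 (F2 - {z})"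
    by (rule extendable_remove[OF ext2 finite_L F2(3) mu2 large g2 NF Z]) simp
  obtain u where u: "u \<in> L1" "z \<in> nb D A (u, Plus)" using z unfolding N1_def by auto
  obtain w where w: "w \<in> L2" "z \<in> nb D A (w, Minus)" using z unfolding N2_def by auto
  obtain p ys1 where p: "p \<in> P0" "length ys1 = k" "distinct ys1" "path_edges Plus p ys1 \<subseteq> T1" "last (p # ys1) = u"
    using L1(3) u by blast
  obtain q ys2 where q: "q \<in> Q0" "length ys2 = k" "distinct ys2" "path_edges Minus q ys2 \<subseteq> T2" "last (q # ys2) = w"
    using L2(3) w by blast
  \<comment> \<open>\<open>E\<close> consists of the tree edges kept for the new path; all others
    are returned.\<close>
  define E where "E = path_edges Plus p ys1 \<union> path_edges Minus q ys2"
  define ys where "ys = ys1 @ z # rev ys2"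
  have sy1: "set ys1 \<subseteq> snd ` T1" using image_mono[OF p(4), of snd] by (simp add: snd_path_edges)
  have sy2: "set ys2 \<subseteq> snd ` T2" using image_mono[OF q(4), of snd] by (simp add: snd_path_edges)
  have dist: "distinct ys"
    using p(3) q(3) sy1 sy2 T2(3) z(1) unfolding ys_def F2_def F1_def by auto
  have T2F: "snd ` T2 \<subseteq> F" using T2(3) F1(2) by (rule order_trans)
  have set_ys: "set ys = insert z (set ys1 \<union> set ys2)" unfolding ys_def by auto
  have "z \<in> F" using z(1) F1(2) F2(2) by blast
  then have ysF: "set ys \<subseteq> F"
    using order_trans[OF sy1 T1(3)] order_trans[OF sy2 T2F] unfolding set_ys by simp
  have "successively (\<lambda>u v. u \<rightarrow>\<^bsub>D\<^esub> v) ((p # ys1) @ [z] @ rev (q # ys2))"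
  proof -
    have "u \<rightarrow>\<^bsub>D\<^esub> z" "z \<rightarrow>\<^bsub>D\<^esub> w" using u(2) w(2) by (auto simp: nb_def)
    moreover have "hd (rev (q # ys2)) = w" using q(5) by (metis hd_rev)
    moreover have "rev (q # ys2) \<noteq> []" by simp
    ultimately show ?thesis
      using successively_path_edges_Plus[OF p(4) T1(4)] successively_path_edges_Minus[OF q(4) T2(4)] p(5)
      by (simp only: successively_append_iff successively.simps last.simps list.sel) auto
  qed
  then have succ: "successively (\<lambda>u v. u \<rightarrow>\<^bsub>D\<^esub> v) (p # ys @ [q])" unfolding ys_def by simp
  let ?T = "T1 \<union> T2"
  have sd: "snd ` T1 \<inter> snd ` T2 = {}" using T2(3) unfolding F1_def by auto
  have dj: "T1 \<inter> T2 = {}" using sd by auto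
  have injT: "inj_on snd ?T" using T1(2) T2(2) sd by (auto simp: inj_on_Un)
  have ET: "E \<subseteq> ?T" using p(4) q(4) unfolding E_def by auto
  have sndE: "snd ` E = set ys1 \<union> set ys2" unfolding E_def image_Un snd_path_edges ..
  have sndTE: "snd ` (?T - E) = (snd ` T1 \<union> snd ` T2) - (set ys1 \<union> set ys2)"
    using inj_on_image_set_diff[OF injT Diff_subset ET] sndE by (simp add: image_Un)
  \<comment> \<open>After the return, only the inner vertices of the new path have left the free
    set.\<close>
  have Feq: "(F2 - {z}) \<union> snd ` (?T - E) = F - set ys"
  proof -
    have gen: "(F - S1 - S2 - {z}) \<union> ((S1 \<union> S2) - (Y1 \<union> Y2)) = F - insert z (Y1 \<union> Y2)"
      if "S1 \<subseteq> F" "S2 \<subseteq> F" "Y1 \<subseteq> S1" "Y2 \<subseteq> S2" "z \<notin> S1 \<union> S2" for S1 S2 Y1 Y2 :: "'a set"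
      using that by blast
    have "z \<notin> snd ` T1 \<union> snd ` T2" using z(1) unfolding F2_def F1_def by simp
    then show ?thesis unfolding sndTE F2_def F1_def set_ys by (intro gen T1(3) T2F sy1 sy2)
  qed
  have "ext (\<lambda>x. g2 x + outdeg (?T - E) x) ((F2 - {z}) \<union> snd ` (?T - E))"
  proof (rule extendable_restore[OF _ z(2) _ finite_L])
    show "inj_on snd (?T - E)" using injT by (rule inj_on_subset) auto
    show "snd ` (?T - E) \<inter> (F2 - {z}) = {}" unfolding F2_def F1_def by auto
    show "snd e \<in> nb D A (fst e)" if "e \<in> ?T - E" for e using that T1(4) T2(4) by auto
  qed (use T1(1) T2(1) F2(3) in auto)
  then have ext3: "ext (\<lambda>x. g2 x + outdeg (?T - E) x) (F - set ys)" unfolding Feq .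
  \<comment> \<open>The parents in \<open>E\<close> are \<open>p\<close>, \<open>q\<close> and
    vertices of \<open>ys\<close>, each with the sign of its tree. All of them have lost their
    demand at that sign, so a left vertex that still has demand gets back every child it had
    claimed.\<close>
  have "demand (P - {p}) (Q - {q}) (F - set ys) x \<le> g2 x + outdeg (?T - E) x" for x
  proof (cases "demand (P - {p}) (Q - {q}) (F - set ys) x = 0")
    case False
    obtain v s where x: "x = (v, s)" by force
    have dx: "demand P Q F x = 2" "demand (P - {p}) (Q - {q}) (F - set ys) x = 2"
      using False unfolding x demand_def by (auto split: if_splits)
    have "x \<notin> fst ` E"
    proof
      assume "x \<in> fst ` E"
      then have "x \<in> insert p (set ys1) \<times> {Plus} \<or> x \<in> insert q (set ys2) \<times> {Minus}"
        using fst_path_edges[of Plus p ys1] fst_path_edges[of Minus q ys2] unfolding E_def image_Un by blast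
      moreover have "p \<notin> F" "q \<notin> F" using p(1) q(1) P0 P Q0 Q by auto
      moreover have "set ys1 \<inter> P = {}" "set ys2 \<inter> Q = {}" using ysF P Q unfolding ys_def by auto
      moreover have "set ys1 \<subseteq> set ys" "set ys2 \<subseteq> set ys" unfolding ys_def by auto
      ultimately show False using False unfolding x demand_def by (auto split: if_splits)
    qed
    then have "{e \<in> ?T - E. fst e = x} = {e \<in> ?T. fst e = x}" by (auto simp: image_iff)
    then have "outdeg (?T - E) x = outdeg T1 x + outdeg T2 x"
      using outdeg_Un[OF T1(1) T2(1) dj, of x] by simp
    then show ?thesis
      using T1(8)[rule_format, of x] T2(8)[rule_format, of x] dx by linarith
  qed simp
  then have "ext (demand (P - {p}) (Q - {q}) (F - set ys)) (F - set ys)"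
    using extendable_mono[OF ext3] by blast
  moreover have "length ys = 2 * k + 1" unfolding ys_def using p(2) q(2) by simp
  ultimately show ?thesis using p(1) q(1) dist ysF succ by blast
qed

end

section \<open>Merging all paths into a cycle\<close>

lemma square_le_power2: "(k :: nat) ^ 2 \<le> 2 * 2 ^ k"
proof (induction k)
  case (Suc k)
  consider "k \<le> 2" | "k \<ge> 3" by linarith
  then show ?case
  proof cases
    case 1
    then have "k \<in> {0, 1, 2}" by auto
    then show ?thesis by (auto simp: power2_eq_square)
  next
    case 2
    then have "k * k \<ge> 3 * k" by simp
    moreover have "Suc k ^ 2 = k * k + 2 * k + 1" by (simp add: power2_eq_square)
    ultimately have "Suc k ^ 2 \<le> 2 * k ^ 2" using 2 unfolding power2_eq_square by linarith
    then show ?thesis using Suc by simp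
  qed
qed simp

text \<open>The least \<open>k\<close> that gives \<open>\<mu>\<close> leaves is used. Replacing
  \<open>2 ^ k\<close> by the cruder \<open>k ^ 2\<close> bounds \<open>k\<close> by a constant
  times the square root of \<open>\<mu> / t\<close>, which is the order of the increment of the
  square root of \<open>\<mu> * t\<close> in \<open>t\<close>. The factor 3 covers
  \<open>r = t div 2\<close>, with \<open>t = 3\<close> the worst case.\<close>

lemma forest_depth:
  fixes \<mu> r t :: nat
  assumes "\<mu> > 0" "r > 0" "t \<le> 3 * r" "t > 0"
  obtains k where "\<mu> \<le> 2 ^ k * r" "k = 0 \<or> 2 ^ k * r \<le> 2 * \<mu>"
    "2 * real k \<le> 16 * (sqrt (real \<mu> * real t) - sqrt (real \<mu> * real (t - 1)))"
proof -
  define k where "k = (LEAST k. \<mu> \<le> 2 ^ k * r)"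
  have "\<mu> \<le> 2 ^ \<mu> * r" using assms(2) less_exp[of \<mu>] by (metis le_trans less_imp_le mult_le_mono2 mult.right_neutral Suc_leI One_nat_def)
  then have k1: "\<mu> \<le> 2 ^ k * r" unfolding k_def by (rule LeastI)
  have k2: "k = 0 \<or> 2 ^ k * r \<le> 2 * \<mu>"
  proof (cases k)
    case (Suc j)
    then have "\<not> \<mu> \<le> 2 ^ j * r" using not_less_Least[of j "\<lambda>k. \<mu> \<le> 2 ^ k * r"] unfolding k_def by simp
    then show ?thesis using Suc by simp
  qed simp
  have kr: "k ^ 2 * r \<le> 4 * \<mu>"
  proof (cases "k = 0")
    case False
    have "k ^ 2 * r \<le> 2 * (2 ^ k * r)"
      using mult_le_mono1[OF square_le_power2[of k], of r] by (simp only: mult.assoc)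
    moreover have "2 ^ k * r \<le> 2 * \<mu>" using False k2 by simp
    ultimately show ?thesis by linarith
  qed simp
  have "k ^ 2 * t \<le> k ^ 2 * (3 * r)" using assms(3) by (rule mult_le_mono2)
  also have "\<dots> = 3 * (k ^ 2 * r)" by simp
  also have "\<dots> \<le> 12 * \<mu>" using kr by linarith
  finally have kt: "real k ^ 2 * real t \<le> 12 * real \<mu>"
    by (metis of_nat_le_iff of_nat_mult of_nat_numeral of_nat_power)
  \<comment> \<open>With \<open>a\<close> and \<open>b\<close> as consecutive values of the square
    root, \<open>(a - b) * (a + b) = \<mu>\<close> and \<open>a + b \<le> 2 * a\<close> turn a bound
    on \<open>k * a\<close> into one by \<open>a - b\<close>.\<close>
  define a where "a = sqrt (real \<mu> * real t)"
  define b where "b = sqrt (real \<mu> * real (t - 1))"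
  have a: "a > 0" "a ^ 2 = real \<mu> * real t" using assms unfolding a_def by auto
  have b: "b \<ge> 0" "b \<le> a" "b ^ 2 = real \<mu> * real (t - 1)" using assms unfolding a_def b_def by auto
  have ab: "(a - b) * (a + b) = real \<mu>"
  proof -
    have "(a - b) * (a + b) = a ^ 2 - b ^ 2" by (simp add: algebra_simps power2_eq_square)
    also have "\<dots> = real \<mu> * (real t - real (t - 1))" unfolding a b by (simp add: algebra_simps)
    finally show ?thesis using assms by (simp add: of_nat_diff)
  qed
  have "(real k * a) ^ 2 = real \<mu> * (real k ^ 2 * real t)" by (simp add: power_mult_distrib a)
  also have "\<dots> \<le> real \<mu> * (12 * real \<mu>)" using kt by (intro mult_left_mono) auto
  also have "\<dots> \<le> (4 * real \<mu>) ^ 2" by (simp add: power2_eq_square)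
  finally have "real k * a \<le> 4 * real \<mu>" by (rule power2_le_imp_le) simp
  also have "\<dots> \<le> 4 * ((a - b) * (2 * a))"
    unfolding ab[symmetric] using a b by (intro mult_left_mono) auto
  finally have "a * real k \<le> a * (8 * (a - b))" by (simp add: algebra_simps)
  then have "real k \<le> 8 * (a - b)" using a by simp
  then show ?thesis using that[OF k1 k2] unfolding a_def b_def by simp
qed

context expanding
begin

text \<open>The square root is a potential for the sum of the tree depths: \<open>2 * k\<close> is at most
  its decrease when the number of paths drops by one.\<close>

lemma link_paths:
  fixes E :: "('a \<times> 'a) set"
  defines "S \<equiv> \<lambda>u v. u \<rightarrow>\<^bsub>D\<^esub> v \<or> (u, v) \<in> E"
  assumes "finite \<P>" "card \<P> = Suc n"
    and "\<forall>a\<in>\<P>. a \<noteq> [] \<and> distinct a \<and> set a \<subseteq> W \<and> set a \<inter> F = {} \<and> successively S a"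
    and "\<forall>a\<in>\<P>. \<forall>b\<in>\<P>. a \<noteq> b \<longrightarrow> set a \<inter> set b = {}"
    and "F \<subseteq> A" "ext (demand (last ` \<P>) (hd ` \<P>) F) F"
    and "\<forall>(u, v)\<in>E. \<exists>a\<in>\<P>. \<exists>as bs. a = as @ u # v # bs"
    and "real (card (A - F)) + real (Suc n) + 16 * sqrt (real \<mu> * real (Suc n)) + 20 * real \<mu> < \<eta> * real (card A)"
  shows "\<exists>c. c \<noteq> [] \<and> distinct c \<and> set c \<subseteq> W \<and> successively S (c @ [hd c]) \<and>
    (\<forall>(u, v)\<in>E. \<exists>as bs. c = as @ u # v # bs)"
  using assms(2-)
proof (induction n arbitrary: \<P> F)
  case 0
  obtain a where a: "\<P> = {a}" using 0(2) card_1_singletonE by auto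
  have anz: "a \<noteq> []" "distinct a" "set a \<subseteq> W" "set a \<inter> F = {}" "successively S a" using 0(3) a by auto
  have room: "real (card (A - F)) + 20 * real \<mu> < \<eta> * real (card A)"
  proof -
    have "0 \<le> sqrt (real \<mu> * real (Suc 0))" "0 \<le> real (Suc 0)" by simp_all
    then show ?thesis using 0(8) by linarith
  qed
  \<comment> \<open>A single path is left; one out-tree from its end and one in-tree from its start
    close it up.\<close>
  obtain k where k: "\<mu> \<le> 2 ^ k * 1" "k = 0 \<or> 2 ^ k * 1 \<le> 2 * \<mu>"
    using forest_depth[of \<mu> 1 1] mu_pos by auto
  have mem: "last a \<in> set a" "hd a \<in> set a" "last a \<notin> F" "hd a \<notin> F"
    using anz by (auto dest: last_in_set hd_in_set)
  have "\<exists>p\<in>{last a}. \<exists>q\<in>{hd a}. \<exists>ys. length ys = 2 * k + 1 \<and> distinct ys \<and> set ys \<subseteq> F \<and>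
    successively (\<lambda>u v. u \<rightarrow>\<^bsub>D\<^esub> v) (p # ys @ [q]) \<and>
    ext (demand (last ` \<P> - {p}) (hd ` \<P> - {q}) (F - set ys)) (F - set ys)"
    by (rule connect[OF 0(6) 0(5) _ _ _ _ _ _ _ _ k room]) (use mem anz a in auto)
  then obtain ys where ys: "distinct ys" "set ys \<subseteq> F" "successively (\<lambda>u v. u \<rightarrow>\<^bsub>D\<^esub> v) (last a # ys @ [hd a])"
    by blast
  have "successively S (last a # ys @ [hd a])"
    using ys(3) by (rule successively_mono) (simp add: S_def)
  then have "successively S (a @ ys @ [hd a])"
    using anz by (cases "ys @ [hd a]") (auto simp: successively_append_iff)
  then have "successively S ((a @ ys) @ [hd (a @ ys)])" using anz by simp
  moreover have "distinct (a @ ys)" using anz ys by auto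
  moreover have "set (a @ ys) \<subseteq> W" using anz ys 0(5) A_subset by auto
  moreover have "\<forall>(u, v)\<in>E. \<exists>as bs. a @ ys = as @ u # v # bs"
  proof clarify
    fix u v assume "(u, v) \<in> E"
    then obtain as bs where "a = as @ u # v # bs" using 0(7) a by auto
    then show "\<exists>as bs. a @ ys = as @ u # v # bs" by (intro exI[of _ as] exI[of _ "bs @ ys"]) simp
  qed
  ultimately show ?case using anz by (intro exI[of _ "a @ ys"]) auto
next
  case (Suc n)
  note fin = Suc.prems(1) and cP = Suc.prems(2) and paths = Suc.prems(3) and disj = Suc.prems(4)
    and FA = Suc.prems(5) and ext = Suc.prems(6) and cov = Suc.prems(7) and budget = Suc.prems(8)
  define t where "t = Suc (Suc n)"
  \<comment> \<open>Half of the paths offer their ends and as many others their starts.\<close>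
  define r where "r = t div 2"
  have r: "r > 0" "t \<le> 3 * r" "2 * r \<le> t" unfolding r_def t_def by auto
  obtain k where k: "\<mu> \<le> 2 ^ k * r" "k = 0 \<or> 2 ^ k * r \<le> 2 * \<mu>"
    and len: "2 * real k \<le> 16 * (sqrt (real \<mu> * real t) - sqrt (real \<mu> * real (t - 1)))"
    using forest_depth[OF mu_pos r(1,2)] unfolding t_def by auto
  \<comment> \<open>\<open>P1\<close> and \<open>P2\<close> are chosen disjoint so that two
    different paths get joined and none is closed up early.\<close>
  obtain P1 where P1: "P1 \<subseteq> \<P>" "card P1 = r"
    using obtain_subset_with_card_n[of r \<P>] r cP unfolding t_def by auto
  have "r \<le> card (\<P> - P1)"
    using r cP P1 fin card_Diff_subset[of P1 \<P>] finite_subset[OF P1(1) fin] unfolding t_def by simp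
  then obtain P2 where P2: "P2 \<subseteq> \<P> - P1" "card P2 = r"
    using obtain_subset_with_card_n by metis
  have inj: "inj_on last \<P>" "inj_on hd \<P>"
  proof -
    have mem: "last a \<in> set a" "hd a \<in> set a" if "a \<in> \<P>" for a using paths that by auto
    show "inj_on last \<P>" "inj_on hd \<P>"
      unfolding inj_on_def using mem disj by (metis disjoint_iff)+
  qed
  have inW: "last a \<in> W" "hd a \<in> W" "last a \<notin> F" "hd a \<notin> F" if "a \<in> \<P>" for a
    using paths that by (meson disjoint_iff hd_in_set last_in_set subsetD)+
  have room: "real (card (A - F)) + 20 * real \<mu> < \<eta> * real (card A)"
  proof -
    have "0 \<le> sqrt (real \<mu> * real (Suc (Suc n)))" "0 \<le> real (Suc (Suc n))" by simp_all
    then show ?thesis using budget by linarith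
  qed
  have "\<exists>p\<in>last ` P1. \<exists>q\<in>hd ` P2. \<exists>ys. length ys = 2 * k + 1 \<and> distinct ys \<and> set ys \<subseteq> F \<and>
    successively (\<lambda>u v. u \<rightarrow>\<^bsub>D\<^esub> v) (p # ys @ [q]) \<and>
    ext (demand (last ` \<P> - {p}) (hd ` \<P> - {q}) (F - set ys)) (F - set ys)"
  proof (rule connect[OF ext FA _ _ _ _ _ _ _ _ k room])
    show "card (last ` P1) = r" using P1 inj by (metis card_image inj_on_subset)
    show "card (hd ` P2) = r" using P2 inj by (metis Diff_subset card_image inj_on_subset)
  qed (use inW P1 P2 in auto)
  then obtain a b ys where a: "a \<in> P1" and b: "b \<in> P2"
    and ys: "length ys = 2 * k + 1" "distinct ys" "set ys \<subseteq> F"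
      "successively (\<lambda>u v. u \<rightarrow>\<^bsub>D\<^esub> v) (last a # ys @ [hd b])"
      "ext (demand (last ` \<P> - {last a}) (hd ` \<P> - {hd b}) (F - set ys)) (F - set ys)"
    by auto
  have ab: "a \<in> \<P>" "b \<in> \<P>" "a \<noteq> b" using a b P1 P2 by auto
  have pa: "a \<noteq> []" "distinct a" "set a \<subseteq> W" "set a \<inter> F = {}" "successively S a" using paths ab by auto
  have pb: "b \<noteq> []" "distinct b" "set b \<subseteq> W" "set b \<inter> F = {}" "successively S b" using paths ab by auto
  define c where "c = a @ ys @ b"
  define Q where "Q = insert c (\<P> - {a, b})"
  define G where "G = F - set ys"
  have cab: "set a \<inter> set b = {}" using disj ab by auto
  \<comment> \<open>As \<open>c\<close> is new, the number of paths drops by exactly one. A member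
    of \<open>\<P>\<close> meeting \<open>a\<close> would be \<open>a\<close> itself, but
    \<open>c\<close> is longer.\<close>
  have "c \<notin> \<P>"
  proof
    assume "c \<in> \<P>"
    moreover have "set c \<inter> set a \<noteq> {}" using pa unfolding c_def by auto
    ultimately have "c = a" using disj ab by auto
    then show False using ys(1) unfolding c_def by auto
  qed
  then have cQ: "card Q = Suc n" "finite Q" using fin cP ab unfolding Q_def by auto
  have "successively S (last a # ys @ [hd b])"
    using ys(4) by (rule successively_mono) (simp add: S_def)
  then have "successively S (a @ ys @ b)"
    using pa pb ys(1) by (cases ys) (auto simp: successively_append_iff successively_Cons hd_append)
  then have pc: "c \<noteq> [] \<and> distinct c \<and> set c \<subseteq> W \<and> set c \<inter> G = {} \<and> successively S c"
    using pa pb ys cab FA A_subset unfolding c_def G_def by auto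
  have pathsQ: "\<forall>x\<in>Q. x \<noteq> [] \<and> distinct x \<and> set x \<subseteq> W \<and> set x \<inter> G = {} \<and> successively S x"
    using paths pc unfolding Q_def G_def by auto
  have cdisj: "set c \<inter> set x = {}" if "x \<in> \<P>" "x \<noteq> a" "x \<noteq> b" for x
  proof -
    have "set a \<inter> set x = {}" "set b \<inter> set x = {}" using disj ab that by auto
    moreover have "set ys \<inter> set x = {}" using paths that ys(3) by blast
    ultimately show ?thesis unfolding c_def by auto
  qed
  have disjQ: "\<forall>x\<in>Q. \<forall>y\<in>Q. x \<noteq> y \<longrightarrow> set x \<inter> set y = {}"
  proof (intro ballI impI)
    fix x y assume xy: "x \<in> Q" "y \<in> Q" "x \<noteq> y"
    show "set x \<inter> set y = {}"
    proof (cases "x = c \<or> y = c")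
      case True
      then show ?thesis using xy cdisj[of x] cdisj[of y] unfolding Q_def by blast
    next
      case False
      then show ?thesis using xy disj unfolding Q_def by auto
    qed
  qed
  \<comment> \<open>The merged path starts where \<open>a\<close> did and ends where
    \<open>b\<close> did. Thus only the end of \<open>a\<close> and the start of \<open>b\<close>
    disappear, in agreement with the demand left by \<open>connect\<close>.\<close>
  have lastQ: "last ` Q \<subseteq> last ` \<P> - {last a}"
  proof
    fix v assume "v \<in> last ` Q"
    then obtain x where "x \<in> \<P>" "x \<noteq> a" "v = last x"
      using ab pb unfolding Q_def c_def by auto
    then show "v \<in> last ` \<P> - {last a}" using inj ab by (auto dest: inj_onD)
  qed
  have hdQ: "hd ` Q \<subseteq> hd ` \<P> - {hd b}"
  proof
    fix v assume "v \<in> hd ` Q"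
    then obtain x where "x \<in> \<P>" "x \<noteq> b" "v = hd x"
      using ab pa unfolding Q_def c_def by auto
    then show "v \<in> hd ` \<P> - {hd b}" using inj ab by (auto dest: inj_onD)
  qed
  have extQ: "ext (demand (last ` Q) (hd ` Q) G) G"
  proof (rule extendable_mono)
    show "ext (demand (last ` \<P> - {last a}) (hd ` \<P> - {hd b}) G) G" using ys(5) unfolding G_def .
    fix x :: "'a \<times> dirn"
    obtain v s where "x = (v, s)" by force
    then show "demand (last ` Q) (hd ` Q) G x \<le> demand (last ` \<P> - {last a}) (hd ` \<P> - {hd b}) G x"
      unfolding demand_def using lastQ hdQ by auto
  qed
  have covQ: "\<forall>(u, v)\<in>E. \<exists>x\<in>Q. \<exists>as bs. x = as @ u # v # bs"
  proof clarify
    fix u v assume "(u, v) \<in> E"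
    then obtain x as bs where x: "x \<in> \<P>" "x = as @ u # v # bs" using cov by blast
    consider "x = a" | "x = b" | "x \<in> Q" using x unfolding Q_def by auto
    then show "\<exists>x\<in>Q. \<exists>as bs. x = as @ u # v # bs"
    proof cases
      case 1
      then have "c = as @ u # v # (bs @ ys @ b)" using x unfolding c_def by simp
      then show ?thesis unfolding Q_def by blast
    next
      case 2
      then have "c = (a @ ys @ as) @ u # v # bs" using x unfolding c_def by simp
      then show ?thesis unfolding Q_def by blast
    next
      case 3
      then show ?thesis using x by blast
    qed
  qed
  have "card (A - G) = card (A - F) + (2 * k + 1)"
  proof -
    have "A - G = (A - F) \<union> set ys" using ys(3) FA unfolding G_def by auto
    moreover have "(A - F) \<inter> set ys = {}" using ys(3) by auto
    ultimately show ?thesis using finite_A distinct_card[OF ys(2)] ys(1) by (simp add: card_Un_disjoint)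
  qed
  then have "real (card (A - G)) = real (card (A - F)) + 2 * real k + 1" by simp
  \<comment> \<open>Of the \<open>2 * k + 1\<close> new vertices, one is paid for by the drop in the
    number of paths and \<open>2 * k\<close> by the drop of the square root.\<close>
  then have budgetQ: "real (card (A - G)) + real (Suc n) + 16 * sqrt (real \<mu> * real (Suc n)) + 20 * real \<mu>
      < \<eta> * real (card A)"
    using budget len unfolding t_def by simp
  have "G \<subseteq> A" using FA unfolding G_def by auto
  then show ?case using Suc.IH[OF cQ(2,1) pathsQ disjQ _ extQ covQ budgetQ] by blast
qed

end

section \<open>Cyclic vertex lists as cycles of the digraph\<close>

lemma mem_zip_cycle: "(u, v) \<in> set (zip (as @ u # v # bs) (tl (as @ u # v # bs) @ ws))"
proof (induction as)
  case (Cons x as)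
  then show ?case by (cases as) auto
qed simp

lemma cas_zip:
  assumes "tail G = fst" "head G = snd" "xs \<noteq> []"
  shows "pre_digraph.cas G (hd xs) (zip xs (tl xs @ [w])) w"
  using assms(3)
proof (induction xs)
  case (Cons x xs)
  then show ?case
    by (cases xs) (simp_all add: pre_digraph.cas.simps assms)
qed simp

lemma awalk_verts_zip:
  assumes "tail G = fst" "head G = snd" "xs \<noteq> []"
  shows "pre_digraph.awalk_verts G (hd xs) (zip xs (tl xs @ [w])) = xs @ [w]"
  using assms(3)
proof (induction xs)
  case (Cons x xs)
  then show ?case
    by (cases xs) (simp_all add: pre_digraph.awalk_verts.simps assms)
qed simp

lemma zip_tl_subset:
  assumes "successively S (xs @ [w])"
  shows "set (zip xs (tl xs @ [w])) \<subseteq> {(u, v). S u v}"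
  using assms
proof (induction xs)
  case (Cons x xs)
  then show ?case by (cases xs) auto
qed simp

text \<open>Arcs of \<open>add_edges\<close> are ordered pairs, so the closed walk through
  \<open>c\<close> is \<open>c\<close> zipped with its own rotation. Its vertex list without the
  first entry is that rotation, which is distinct.\<close>

lemma cycle_zip:
  assumes c: "c \<noteq> []" "distinct c" "set c \<subseteq> verts D"
    and succ: "successively (\<lambda>u v. (u, v) \<in> arcs_ends D \<union> E) (c @ [hd c])"
  shows "pre_digraph.cycle (with_proj (add_edges D E)) (zip c (tl c @ [hd c]))"
proof -
  let ?G = "with_proj (add_edges D E)"
  have G: "tail ?G = fst" "head ?G = snd" "arcs ?G = arcs_ends D \<union> E" "verts ?G = verts D"
    by (simp_all add: add_edges_def)
  have "pre_digraph.awalk ?G (hd c) (zip c (tl c @ [hd c])) (hd c)"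
    unfolding pre_digraph.awalk_def
    using cas_zip[OF G(1,2) c(1), of "hd c"] zip_tl_subset[OF succ] c G by (auto simp: subset_iff)
  moreover have "distinct (tl (pre_digraph.awalk_verts ?G (hd c) (zip c (tl c @ [hd c]))))"
    unfolding awalk_verts_zip[OF G(1,2) c(1)] using c by (cases c) auto
  moreover have "zip c (tl c @ [hd c]) \<noteq> []" using c by (cases c; cases "tl c") auto
  ultimately show ?thesis unfolding pre_digraph.cycle_def by blast
qed

section \<open>Expansion of small sets\<close>

text \<open>An averaging argument over all subsets \<open>P\<close> of \<open>Z\<close>: for each
  \<open>v\<close> at least half of them are good, so by double counting some \<open>P\<close> is
  good for at least half of \<open>T\<close>.\<close>

lemma exists_halving_bipartition:
  assumes "finite Z" "T \<subseteq> Z" "\<And>v. v \<in> T \<Longrightarrow> S v \<subseteq> Z - {v}"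
  shows "\<exists>P\<subseteq>Z. card T \<le> 2 * card {v \<in> T. card (S v) \<le> 2 * card {w \<in> S v. (w \<in> P) \<noteq> (v \<in> P)}}"
proof (rule ccontr)
  define good where "good P v \<longleftrightarrow> card (S v) \<le> 2 * card {w \<in> S v. (w \<in> P) \<noteq> (v \<in> P)}" for P v
  assume "\<not> ?thesis"
  then have less: "2 * card {v \<in> T. good P v} < card T" if "P \<in> Pow Z" for P
    using that unfolding good_def by (meson Pow_iff not_le)
  have finT: "finite T" using assms(1,2) by (rule_tac finite_subset)
  have half: "card (Pow Z) \<le> 2 * card {P \<in> Pow Z. good P v}" if v: "v \<in> T" for v
  proof -
    let ?B = "{P \<in> Pow Z. \<not> good P v}" and ?G = "{P \<in> Pow Z. good P v}"
    \<comment> \<open>Moving only \<open>v\<close> to the other side exchanges its separated and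
      unseparated neighbours, because \<open>v\<close> is not in \<open>S v\<close>. This sends bad
      sets injectively to good ones.\<close>
    let ?f = "\<lambda>P. if v \<in> P then P - {v} else insert v P"
    have finS: "finite (S v)" using assms v by (meson finite_Diff finite_subset)
    have "?f ` ?B \<subseteq> ?G"
    proof
      fix Q assume "Q \<in> ?f ` ?B"
      then obtain P where P: "P \<in> Pow Z" "\<not> good P v" "Q = ?f P" by blast
      have "{w \<in> S v. (w \<in> Q) \<noteq> (v \<in> Q)} = S v - {w \<in> S v. (w \<in> P) \<noteq> (v \<in> P)}"
        using assms(3)[OF v] P(3) by auto
      then have "card {w \<in> S v. (w \<in> Q) \<noteq> (v \<in> Q)} = card (S v) - card {w \<in> S v. (w \<in> P) \<noteq> (v \<in> P)}"
        using finS by (simp add: card_Diff_subset)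
      then have "good Q v" using P(2) unfolding good_def by linarith
      moreover have "Q \<in> Pow Z" using P v assms(2) by auto
      ultimately show "Q \<in> ?G" by simp
    qed
    moreover have "inj_on ?f ?B"
      unfolding inj_on_def by (auto split: if_splits)
    ultimately have "card ?B \<le> card ?G" using assms(1) by (intro card_inj_on_le[of ?f]) auto
    moreover have "card (Pow Z) = card ?B + card ?G"
    proof -
      have "card (Pow Z) = card (?B \<union> ?G)" by (rule arg_cong[of _ _ card]) auto
      also have "\<dots> = card ?B + card ?G" using assms(1) by (intro card_Un_disjoint) auto
      finally show ?thesis .
    qed
    ultimately show ?thesis by linarith
  qed
  have "(\<Sum>P\<in>Pow Z. card {v \<in> T. good P v}) = (\<Sum>v\<in>T. card {P \<in> Pow Z. good P v})"
  proof -
    have "(\<Sum>P\<in>Pow Z. card {v \<in> T. good P v}) = (\<Sum>P\<in>Pow Z. \<Sum>v\<in>T. if good P v then 1 else 0)"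
      using finT by (simp add: sum.If_cases Int_def)
    also have "\<dots> = (\<Sum>v\<in>T. \<Sum>P\<in>Pow Z. if good P v then 1 else 0)" by (rule sum.swap)
    also have "\<dots> = (\<Sum>v\<in>T. card {P \<in> Pow Z. good P v})"
      using assms(1) by (simp add: sum.If_cases Int_def)
    finally show ?thesis .
  qed
  then have "card T * card (Pow Z) \<le> 2 * (\<Sum>P\<in>Pow Z. card {v \<in> T. good P v})"
    using sum_mono[of T "\<lambda>_. card (Pow Z)" "\<lambda>v. 2 * card {P \<in> Pow Z. good P v}"] half
    by (simp add: sum_distrib_left)
  moreover have "(\<Sum>P\<in>Pow Z. 2 * card {v \<in> T. good P v}) < (\<Sum>P\<in>Pow Z. card T)"
    using less assms(1) by (intro sum_strict_mono) auto
  ultimately show False using assms(1) by (simp add: sum_distrib_left[symmetric] mult.commute)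
qed

text \<open>The assumption \<open>expand\<close> is (A2) for one fixed sign, with \<open>M\<close>
  for 2m and \<open>u\<close> for the degree threshold.\<close>

context
  fixes D :: "('a, 'b) pre_digraph" and s :: dirn and M u :: real
  assumes expand: "\<And>X B. X \<subseteq> verts D \<Longrightarrow> B \<subseteq> verts D \<Longrightarrow> X \<inter> B = {} \<Longrightarrow> real (card X) \<le> M \<Longrightarrow>
      (\<forall>v\<in>X. u \<le> real (deg_in D s v B)) \<Longrightarrow> 10 * card X \<le> card B"
    and loopfree: "\<And>v. \<not> is_nbr D s v v"
    and finite_verts: "finite (verts D)"
begin

lemma card_le_M: "Y \<subseteq> X \<Longrightarrow> finite X \<Longrightarrow> real (card X) \<le> M \<Longrightarrow> real (card Y) \<le> M"
  using card_mono[of X Y] by linarith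

text \<open>The expansion hypothesis only covers disjoint pairs of sets. Half of the rich vertices keep half of
  their neighbours on the other side of a suitable bipartition, where it applies.\<close>

lemma few_internally_rich:
  assumes Z: "Z \<subseteq> verts D" "real (card Z) \<le> M"
  shows "5 * card {v \<in> Z. 2 * u \<le> real (deg_in D s v Z)} \<le> card Z"
proof -
  define S where "S v = {w \<in> Z. is_nbr D s v w}" for v
  define T where "T = {v \<in> Z. 2 * u \<le> real (deg_in D s v Z)}"
  have finZ: "finite Z" using Z finite_verts by (rule_tac finite_subset)
  obtain P where P: "P \<subseteq> Z"
    "card T \<le> 2 * card {v \<in> T. card (S v) \<le> 2 * card {w \<in> S v. (w \<in> P) \<noteq> (v \<in> P)}}"
    using exists_halving_bipartition[OF finZ, of T S] loopfree unfolding S_def T_def by blast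
  define G where "G = {v \<in> T. card (S v) \<le> 2 * card {w \<in> S v. (w \<in> P) \<noteq> (v \<in> P)}}"
  have G: "G \<subseteq> T" "T \<subseteq> Z" unfolding G_def T_def by auto
  have rich: "u \<le> real (card {w \<in> S v. (w \<in> P) \<noteq> (v \<in> P)})" if "v \<in> G" for v
    using that unfolding G_def T_def deg_in_def S_def by auto
  have "10 * card (G \<inter> P) \<le> card (Z - P)"
  proof (rule expand)
    show "\<forall>v\<in>G \<inter> P. u \<le> real (deg_in D s v (Z - P))"
    proof
      fix v assume v: "v \<in> G \<inter> P"
      then have "{w \<in> S v. (w \<in> P) \<noteq> (v \<in> P)} = {w \<in> Z - P. is_nbr D s v w}" unfolding S_def by auto
      then show "u \<le> real (deg_in D s v (Z - P))" using rich[of v] v unfolding deg_in_def by simp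
    qed
    show "real (card (G \<inter> P)) \<le> M" using G by (intro card_le_M[OF _ finZ Z(2)]) auto
  qed (use G Z in auto)
  moreover have "10 * card (G - P) \<le> card P"
  proof (rule expand)
    show "\<forall>v\<in>G - P. u \<le> real (deg_in D s v P)"
    proof
      fix v assume v: "v \<in> G - P"
      then have "{w \<in> S v. (w \<in> P) \<noteq> (v \<in> P)} = {w \<in> P. is_nbr D s v w}" using P unfolding S_def by auto
      then show "u \<le> real (deg_in D s v P)" using rich[of v] v unfolding deg_in_def by simp
    qed
    show "real (card (G - P)) \<le> M" using G by (intro card_le_M[OF _ finZ Z(2)]) auto
  qed (use G Z P in auto)
  moreover have "card G = card (G \<inter> P) + card (G - P)"
    using finZ G by (metis card_Diff_subset_Int card_Int_Diff finite_subset)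
  moreover have "card Z = card P + card (Z - P)"
    using finZ P by (metis Int_absorb1 card_Int_Diff)
  \<comment> \<open>Adding the two expansion bounds gives ten times the size of \<open>G\<close> on
    the left and the size of \<open>Z\<close> on the right, and \<open>G\<close> is at least half of
    \<open>T\<close>.\<close>
  ultimately have "5 * card T \<le> card Z" using P(2) unfolding G_def[symmetric] by linarith
  then show ?thesis unfolding T_def .
qed

text \<open>At most a fifth of \<open>X\<close> has many neighbours inside \<open>X\<close>. The
  other vertices keep at least \<open>u\<close> of their \<open>3 * u\<close> neighbours outside
  \<open>X\<close>, so (A2) applies to them with factor 10, and four fifths of 10 is 8.\<close>

lemma neighbourhood_expands:
  assumes A: "A \<subseteq> verts D" and X: "X \<subseteq> verts D" "real (card X) \<le> M"
    and deg: "\<forall>v\<in>X. 3 * u \<le> real (deg_in D s v A)"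
  shows "8 * card X \<le> card (\<Union>v\<in>X. {w \<in> A. is_nbr D s v w})"
proof -
  define N where "N = (\<Union>v\<in>X. {w \<in> A. is_nbr D s v w})"
  define T where "T = {v \<in> X. 2 * u \<le> real (deg_in D s v X)}"
  have finX: "finite X" using X finite_verts by (rule_tac finite_subset)
  have finA: "finite A" using A finite_verts by (rule_tac finite_subset)
  have NA: "N \<subseteq> A" unfolding N_def by auto
  have "10 * card (X - T) \<le> card (N - X)"
  proof (rule expand)
    show "\<forall>v\<in>X - T. u \<le> real (deg_in D s v (N - X))"
    proof
      fix v assume v: "v \<in> X - T"
      have "{w \<in> A. is_nbr D s v w} \<subseteq> {w \<in> N - X. is_nbr D s v w} \<union> {w \<in> X. is_nbr D s v w}"
        using v unfolding N_def by auto
      then have "card {w \<in> A. is_nbr D s v w}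
          \<le> card ({w \<in> N - X. is_nbr D s v w} \<union> {w \<in> X. is_nbr D s v w})"
        using finX finA NA by (intro card_mono) (auto intro: finite_subset)
      also have "\<dots> \<le> card {w \<in> N - X. is_nbr D s v w} + card {w \<in> X. is_nbr D s v w}" by (rule card_Un_le)
      finally have "deg_in D s v A \<le> deg_in D s v (N - X) + deg_in D s v X" unfolding deg_in_def .
      moreover have "real (deg_in D s v X) < 2 * u" using v unfolding T_def by auto
      ultimately show "u \<le> real (deg_in D s v (N - X))" using deg v by fastforce
    qed
    show "real (card (X - T)) \<le> M" by (intro card_le_M[OF _ finX X(2)]) auto
  qed (use X A NA in auto)
  moreover have "card (N - X) \<le> card N" using NA finA by (intro card_mono) (auto intro: finite_subset)
  moreover have "card X = card T + card (X - T)"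
    using finX by (metis (no_types, lifting) Int_absorb1 T_def card_Int_Diff mem_Collect_eq subsetI)
  moreover have "5 * card T \<le> card X" using few_internally_rich[OF X] unfolding T_def .
  ultimately show ?thesis unfolding N_def by linarith
qed

end

section \<open>Size estimates\<close>

text \<open>The last three inequalities are the inputs of \<open>size_budget\<close>: they control
  the size of the set V, the size of m, and the error from rounding m up.\<close>

lemma eventually_iterated_logs:
  fixes \<eta> :: real
  assumes "\<eta> > 0"
  shows "\<exists>n0::nat. \<forall>n\<ge>n0. n > 0 \<and> ln (real n) > 0 \<and> ilog 2 (real n) > 0 \<and> ilog 3 (real n) > 0 \<and>
    ilog 4 (real n) > 0 \<and> ilog 6 (real n) > 0 \<and> 36 / \<eta> \<le> ilog 6 (real n) \<and>
    11200000 * (ilog 3 (real n) * ilog 4 (real n)) \<le> \<eta> * ilog 2 (real n) \<and>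
    112 * (ln (real n) * ilog 4 (real n)) \<le> \<eta> * (real n * ilog 2 (real n))"
proof -
  have logs: "ilog 2 = (\<lambda>x. ln (ln x))" "ilog 3 = (\<lambda>x. ln (ln (ln x)))"
    "ilog 4 = (\<lambda>x. ln (ln (ln (ln x))))" "ilog 6 = (\<lambda>x. ln (ln (ln (ln (ln (ln x))))))"
    by (simp_all add: ilog_def fun_eq_iff eval_nat_numeral)
  have top: "filterlim (\<lambda>n. real n) at_top sequentially" by (rule filterlim_real_sequentially)
  have t1: "filterlim (\<lambda>n. ln (real n)) at_top sequentially"
    using filterlim_compose[OF ln_at_top top] by simp
  have t2: "filterlim (\<lambda>n. ilog 2 (real n)) at_top sequentially"
    using filterlim_compose[OF ln_at_top t1] unfolding logs by simp
  have t3: "filterlim (\<lambda>n. ilog 3 (real n)) at_top sequentially"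
    using filterlim_compose[OF ln_at_top t2] unfolding logs by simp
  have t4: "filterlim (\<lambda>n. ilog 4 (real n)) at_top sequentially"
    using filterlim_compose[OF ln_at_top t3] unfolding logs by simp
  have t6: "filterlim (\<lambda>n. ilog 6 (real n)) at_top sequentially"
    using filterlim_compose[OF ln_at_top filterlim_compose[OF ln_at_top t4]] unfolding logs by simp
  \<comment> \<open>The quotient depends on n only through y, its twice iterated logarithm, so the
    limit is taken in y.\<close>
  have "((\<lambda>y::real. ln y * ln (ln y) / y) \<longlongrightarrow> 0) at_top" by real_asymp
  from filterlim_compose[OF this t2]
  have l1: "(\<lambda>n. ilog 3 (real n) * ilog 4 (real n) / ilog 2 (real n)) \<longlonglongrightarrow> 0"
    unfolding logs by simp
  have l2: "(\<lambda>n. ln (real n) * ilog 4 (real n) / (real n * ilog 2 (real n))) \<longlonglongrightarrow> 0"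
    unfolding logs by real_asymp
  have pos: "\<forall>\<^sub>F n in sequentially. n > 0 \<and> ln (real n) > 0 \<and> ilog 2 (real n) > 0 \<and> ilog 3 (real n) > 0 \<and>
      ilog 4 (real n) > 0 \<and> ilog 6 (real n) > 0 \<and> 36 / \<eta> \<le> ilog 6 (real n)"
    using t1 t2 t3 t4 t6 eventually_gt_at_top[of "0::nat"] t6[unfolded filterlim_at_top, rule_format, of "36 / \<eta>"]
    by (intro eventually_conj) (auto simp: filterlim_at_top_dense)
  have e1: "\<forall>\<^sub>F n in sequentially. ilog 3 (real n) * ilog 4 (real n) / ilog 2 (real n) < \<eta> / 11200000"
    by (rule order_tendstoD(2)[OF l1]) (use assms in simp)
  have e2: "\<forall>\<^sub>F n in sequentially. ln (real n) * ilog 4 (real n) / (real n * ilog 2 (real n)) < \<eta> / 112"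
    by (rule order_tendstoD(2)[OF l2]) (use assms in simp)
  have "\<forall>\<^sub>F n in sequentially. n > 0 \<and> ln (real n) > 0 \<and> ilog 2 (real n) > 0 \<and> ilog 3 (real n) > 0 \<and>
    ilog 4 (real n) > 0 \<and> ilog 6 (real n) > 0 \<and> 36 / \<eta> \<le> ilog 6 (real n) \<and>
    11200000 * (ilog 3 (real n) * ilog 4 (real n)) \<le> \<eta> * ilog 2 (real n) \<and>
    112 * (ln (real n) * ilog 4 (real n)) \<le> \<eta> * (real n * ilog 2 (real n))"
    using pos e1 e2
  proof eventually_elim
    case (elim n)
    have "ilog 3 (real n) * ilog 4 (real n) < \<eta> / 11200000 * ilog 2 (real n)"
      using elim(1,2) by (simp only: pos_divide_less_eq)
    moreover have "ln (real n) * ilog 4 (real n) < \<eta> / 112 * (real n * ilog 2 (real n))"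
      using elim(1,3) by (simp only: pos_divide_less_eq mult_pos_pos of_nat_0_less_iff)
    ultimately show ?case using elim(1) by simp
  qed
  then show ?thesis unfolding eventually_sequentially .
qed

text \<open>The term \<open>9 * v\<close> and the two parts of \<open>28 * (m + 1)\<close> each take
  at most a quarter of \<open>\<eta> * a\<close>. The constants follow: 36 is 9 times 4, 112 is 28
  times 4, and 11200000 also absorbs the factor \<open>10 ^ 5\<close> from the lower bound on
  \<open>d\<close>.\<close>

lemma size_budget:
  fixes \<eta> d a v x L l2 l3 l4 l6 m :: real and \<mu> :: nat
  assumes pos: "\<eta> > 0" "d \<ge> 1 / 10 ^ 5" "x > 0" "L > 0" "l2 > 0" "l3 > 0" "l4 > 0" "l6 > 0"
    and h: "36 / \<eta> \<le> l6" "11200000 * (l3 * l4) \<le> \<eta> * l2" "112 * (L * l4) \<le> \<eta> * (x * l2)"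
    and a: "x * l2 / (L * l4) \<le> a" and v: "v \<le> a / l6"
    and m: "m = x * l3 / (d * L)" and mu: "\<mu> = nat \<lceil>m\<rceil>"
  shows "9 * v + 28 * real \<mu> < \<eta> * a"
proof -
  let ?b = "x * l2 / (L * l4)"
  define p where "p = \<eta> * a"
  define q where "q = \<eta> * ?b"
  have b: "?b > 0" using pos by simp
  then have apos: "a > 0" using a by simp
  have d: "d > 0" using pos(2) by (rule less_le_trans[rotated]) simp
  have "a / l6 \<le> a * (\<eta> / 36)"
  proof -
    have "1 / l6 \<le> \<eta> / 36" using h(1) pos by (simp add: field_simps)
    then have "a * (1 / l6) \<le> a * (\<eta> / 36)" using apos by (intro mult_left_mono) auto
    then show ?thesis by simp
  qed
  also have "a * (\<eta> / 36) = \<eta> * a / 36" by simp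
  finally have 1: "9 * v \<le> \<eta> * a / 4" using v by linarith
  have "m \<le> 10 ^ 5 * (x * l3 / L)"
  proof -
    have "1 / d \<le> 10 ^ 5" using pos(2) d by (simp add: field_simps)
    then have "(1 / d) * (x * l3 / L) \<le> 10 ^ 5 * (x * l3 / L)" using pos by (intro mult_right_mono) auto
    then show ?thesis unfolding m by simp
  qed
  moreover have "11200000 * (x * l3 / L) \<le> \<eta> * ?b"
  proof -
    have "11200000 * (x * l3 / L) = (11200000 * (l3 * l4)) * (x / (L * l4))" using pos by simp
    also have "\<dots> \<le> (\<eta> * l2) * (x / (L * l4))" using h(2) pos by (intro mult_right_mono) auto
    finally show ?thesis by (simp add: mult.commute mult.left_commute)
  qed
  ultimately have 2: "112 * m \<le> \<eta> * ?b" by simp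
  have "112 \<le> \<eta> * ?b"
  proof -
    have "112 \<le> \<eta> * (x * l2) / (L * l4)" using h(3) pos by (simp add: pos_le_divide_eq)
    then show ?thesis by simp
  qed
  moreover have "\<eta> * ?b \<le> \<eta> * a" using a pos by (intro mult_left_mono) auto
  moreover have "0 < m" unfolding m using pos d by simp
  then have "real \<mu> \<le> m + 1" unfolding mu by linarith
  moreover have "0 < \<eta> * a" using pos apos by simp
  ultimately have "112 \<le> q" "q \<le> p" "real \<mu> \<le> m + 1" "0 < p" "9 * v \<le> p / 4" "112 * m \<le> q"
    using 1 2 unfolding p_def q_def by blast+
  then show ?thesis unfolding p_def[symmetric] by linarith
qed

section \<open>The theorem\<close>

lemma arcs_ends_induce: "(u, v) \<in> arcs_ends (D \<restriction> W) \<longleftrightarrow> u \<rightarrow>\<^bsub>D\<^esub> v \<and> u \<in> W \<and> v \<in> W"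
  by (auto simp: arcs_ends_conv)

text \<open>This serves the empty edge set, for which a cycle must still be exhibited. If the
  relation on \<open>B\<close> were acyclic, its converse would be well-founded by finiteness, and
  some vertex of \<open>B\<close> would have no successor in \<open>B\<close>.\<close>

lemma exists_cycle:
  assumes "finite B" "B \<noteq> {}" "\<forall>u\<in>B. \<exists>v\<in>B. (u, v) \<in> arcs_ends D"
    and ends: "arcs_ends D \<subseteq> verts D \<times> verts D"
  shows "\<exists>p. pre_digraph.cycle (with_proj (add_edges D {})) p"
proof -
  let ?H = "with_proj (add_edges D {})"
  have H: "tail ?H = fst" "head ?H = snd" "arcs ?H = arcs_ends D" "verts ?H = verts D"
    by (simp_all add: add_edges_def)
  interpret wf_digraph ?H by unfold_locales (use ends H in auto)
  have eH: "arcs_ends ?H = arcs_ends D" unfolding arcs_ends_conv[of ?H] H by simp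
  define r where "r = arcs_ends D \<inter> B \<times> B"
  have "finite r" using assms(1) unfolding r_def by simp
  have "\<not> acyclic r"
  proof
    assume "acyclic r"
    then have "wf (r\<inverse>)" using \<open>finite r\<close> by (rule finite_acyclic_wf_converse[rotated])
    then obtain u where u: "u \<in> B" "\<forall>v. (v, u) \<in> r\<inverse> \<longrightarrow> v \<notin> B"
      using assms(2) by (meson ex_in_conv wf_eq_minimal)
    obtain v where "v \<in> B" "(u, v) \<in> arcs_ends D" using assms(3) u(1) by blast
    then show False using u unfolding r_def by blast
  qed
  then obtain u where "(u, u) \<in> r\<^sup>+" unfolding acyclic_def by auto
  then have "(u, u) \<in> (arcs_ends ?H)\<^sup>+" unfolding eH by (rule trancl_mono) (simp add: r_def)
  then obtain p where "awalk u p u" "p \<noteq> []" using reachable1_awalk[of u u] by blast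
  then have "closed_w p" unfolding closed_w_def by blast
  then show ?thesis by (rule closed_w_imp_cycle)
qed

theorem theorem4p8:
  shows "\<forall>\<epsilon>::real. \<epsilon> > 0 \<longrightarrow> (\<exists>n0::nat. \<forall>(d::real) (n::nat) (D :: ('a, 'b) pre_digraph) A V.
    d \<ge> 1 / 10 ^ 5 \<longrightarrow> n \<ge> n0 \<longrightarrow>
    digraph D \<longrightarrow> card (verts D) = n \<longrightarrow> pseudorandom d \<epsilon> D \<longrightarrow>
    A \<subseteq> verts D \<longrightarrow> V \<subseteq> verts D \<longrightarrow> A \<inter> V = {} \<longrightarrow>
    real n * ilog 2 (real n) / (ln (real n) * ilog 4 (real n)) \<le> real (card A) \<longrightarrow>
    real (card A) \<le> real n * ilog 2 (real n) ^ 3 / ln (real n) \<longrightarrow>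
    real (card V) \<le> real (card A) / ilog 6 (real n) \<longrightarrow>
    (\<forall>s. \<forall>v \<in> A \<union> V.
        real (deg_in D s v A) \<ge> 40 * d * ilog 2 (real n) / ilog 4 (real n) \<and>
        real (deg_in D s v (A \<union> V)) \<le> d * ilog 2 (real n) ^ 3) \<longrightarrow>
    (\<forall>s U. U \<subseteq> A \<union> V \<and> card U = nat \<lceil>mparam n d\<rceil> \<longrightarrow>
        real (card (nbhd D s U \<inter> A)) \<ge> (1 / 2 + \<epsilon> / 8) * real (card A)) \<longrightarrow>
    weakly_connected_in V (D \<restriction> (A \<union> V)))"
proof (intro allI impI)
  fix \<epsilon> :: real assume eps: "\<epsilon> > 0"
  \<comment> \<open>The cap at 1/2 makes \<open>\<eta>\<close> times the size of \<open>A\<close> at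
    most half of \<open>A\<close>, which the room estimates in \<open>connect\<close> use.\<close>
  define \<eta> where "\<eta> = min (\<epsilon> / 8) (1 / 2)"
  have eta: "\<eta> > 0" "\<eta> \<le> 1 / 2" "\<eta> \<le> \<epsilon> / 8" using eps unfolding \<eta>_def by auto
  obtain n0 where n0: "\<forall>n\<ge>n0. n > 0 \<and> ln (real n) > 0 \<and> ilog 2 (real n) > 0 \<and> ilog 3 (real n) > 0 \<and>
    ilog 4 (real n) > 0 \<and> ilog 6 (real n) > 0 \<and> 36 / \<eta> \<le> ilog 6 (real n) \<and>
    11200000 * (ilog 3 (real n) * ilog 4 (real n)) \<le> \<eta> * ilog 2 (real n) \<and>
    112 * (ln (real n) * ilog 4 (real n)) \<le> \<eta> * (real n * ilog 2 (real n))"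
    using eventually_iterated_logs[OF eta(1)] by blast
  show "\<exists>n0::nat. \<forall>(d::real) (n::nat) (D :: ('a, 'b) pre_digraph) A V.
    d \<ge> 1 / 10 ^ 5 \<longrightarrow> n \<ge> n0 \<longrightarrow>
    digraph D \<longrightarrow> card (verts D) = n \<longrightarrow> pseudorandom d \<epsilon> D \<longrightarrow>
    A \<subseteq> verts D \<longrightarrow> V \<subseteq> verts D \<longrightarrow> A \<inter> V = {} \<longrightarrow>
    real n * ilog 2 (real n) / (ln (real n) * ilog 4 (real n)) \<le> real (card A) \<longrightarrow>
    real (card A) \<le> real n * ilog 2 (real n) ^ 3 / ln (real n) \<longrightarrow>
    real (card V) \<le> real (card A) / ilog 6 (real n) \<longrightarrow>
    (\<forall>s. \<forall>v \<in> A \<union> V.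
        real (deg_in D s v A) \<ge> 40 * d * ilog 2 (real n) / ilog 4 (real n) \<and>
        real (deg_in D s v (A \<union> V)) \<le> d * ilog 2 (real n) ^ 3) \<longrightarrow>
    (\<forall>s U. U \<subseteq> A \<union> V \<and> card U = nat \<lceil>mparam n d\<rceil> \<longrightarrow>
        real (card (nbhd D s U \<inter> A)) \<ge> (1 / 2 + \<epsilon> / 8) * real (card A)) \<longrightarrow>
    weakly_connected_in V (D \<restriction> (A \<union> V))"
  proof (intro exI[of _ n0] allI impI)
    fix d :: real and n :: nat and D :: "('a, 'b) pre_digraph" and A V :: "'a set"
    assume d: "d \<ge> 1 / 10 ^ 5" and n: "n \<ge> n0" and dig: "digraph D" and cD: "card (verts D) = n"
      and pr: "pseudorandom d \<epsilon> D" and A: "A \<subseteq> verts D" and V: "V \<subseteq> verts D" and AV: "A \<inter> V = {}"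
      and A_large: "real n * ilog 2 (real n) / (ln (real n) * ilog 4 (real n)) \<le> real (card A)"
      and V_small: "real (card V) \<le> real (card A) / ilog 6 (real n)"
      and deg: "\<forall>s. \<forall>v \<in> A \<union> V.
        real (deg_in D s v A) \<ge> 40 * d * ilog 2 (real n) / ilog 4 (real n) \<and>
        real (deg_in D s v (A \<union> V)) \<le> d * ilog 2 (real n) ^ 3"
      and nbrs: "\<forall>s U. U \<subseteq> A \<union> V \<and> card U = nat \<lceil>mparam n d\<rceil> \<longrightarrow>
        real (card (nbhd D s U \<inter> A)) \<ge> (1 / 2 + \<epsilon> / 8) * real (card A)"
    interpret digraph D by (rule dig)
    define W where "W = A \<union> V"
    define m where "m = mparam n d"
    define \<mu> where "\<mu> = nat \<lceil>m\<rceil>"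
    define u where "u = d * ilog 2 (real n) / ilog 4 (real n)"
    note large = n0[rule_format, OF n]
    have dpos: "d > 0" using d by (rule less_le_trans[rotated]) simp
    have mpos: "m > 0" unfolding m_def mparam_def using large dpos by simp
    have mu: "\<mu> > 0" "real \<mu> < m + 1" unfolding \<mu>_def using mpos by linarith+
    have upos: "u > 0" unfolding u_def using large dpos by simp
    have finA: "finite A" and finV: "finite V" using A V by (auto intro: finite_subset)
    have WD: "W \<subseteq> verts D" and AW: "A \<subseteq> W" and VW: "V \<subseteq> W" and finW: "finite W"
      using A V finA finV unfolding W_def by auto
    have budget: "9 * real (card V) + 28 * real \<mu> < \<eta> * real (card A)"
      by (rule size_budget[OF eta(1) d, of "real n" "ln (real n)" "ilog 2 (real n)" "ilog 3 (real n)"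
            "ilog 4 (real n)" "ilog 6 (real n)"])
        (use large A_large V_small in \<open>auto simp: \<mu>_def m_def mparam_def\<close>)
    have cA: "card A > 0" using budget by (cases "card A") auto
    have degA: "40 * u \<le> real (deg_in D s v A)" if "v \<in> W" for s v
      using deg[rule_format, of v s] that unfolding W_def u_def by (simp add: mult.assoc)
    have loop: "\<not> is_nbr D s v v" for s v by (cases s) (auto dest: adj_not_same)
    have A2: "10 * card X \<le> card B" if "X \<subseteq> verts D" "B \<subseteq> verts D" "X \<inter> B = {}" "real (card X) \<le> 2 * m"
      "\<forall>v\<in>X. u \<le> real (deg_in D s v B)" for s X B
    proof -
      have "\<forall>s A B. A \<subseteq> verts D \<and> B \<subseteq> verts D \<and> A \<inter> B = {} \<and> real (card A) \<le> 2 * m \<and>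
           (\<forall>v\<in>A. real (deg_in D s v B) \<ge> u) \<longrightarrow> card B \<ge> 10 * card A"
        using pr unfolding pseudorandom_def Let_def cD m_def u_def by (elim conjE)
      from this[rule_format, of X B s] show ?thesis using that by simp
    qed
    have expand: "8 * card X \<le> card (\<Union>v\<in>X. nb D A (v, s))" if X: "X \<subseteq> W" "real (card X) \<le> 2 * m" for X s
    proof -
      have "3 * u \<le> real (deg_in D s v A)" if "v \<in> X" for v
        using degA[of v s] that X(1) upos by auto
      then have "8 * card X \<le> card (\<Union>v\<in>X. {w \<in> A. is_nbr D s v w})"
        by (intro neighbourhood_expands[of D "2 * m" u s, OF A2[of _ _ s] loop finite_verts A _ X(2)]
            order_trans[OF X(1) WD] ballI) blast+
      then show ?thesis by (simp add: nb_def)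
    qed
    interpret expanding D A W \<mu> \<eta>
    proof
      fix s X assume X: "X \<subseteq> W" "\<mu> \<le> card X"
      \<comment> \<open>Condition (ii) speaks of sets of size exactly \<open>\<mu>\<close>; a larger
        set inherits the bound from a subset, and \<open>nb\<close> does not exclude neighbours
        inside the set.\<close>
      obtain U where U: "U \<subseteq> X" "card U = \<mu>" using X(2) by (metis obtain_subset_with_card_n)
      have "(1 / 2 + \<eta>) * real (card A) \<le> (1 / 2 + \<epsilon> / 8) * real (card A)"
        using eta by (intro mult_right_mono) auto
      also have "\<dots> \<le> real (card (nbhd D s U \<inter> A))"
        using nbrs U X(1) unfolding W_def \<mu>_def m_def by auto
      also have "\<dots> \<le> real (card (\<Union>v\<in>X. nb D A (v, s)))"
      proof -
        have "nbhd D s U \<inter> A \<subseteq> (\<Union>v\<in>X. nb D A (v, s))" using U unfolding nbhd_def nb_def by auto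
        moreover have "finite (\<Union>v\<in>X. nb D A (v, s))"
          using finA by (rule finite_subset[rotated]) (auto simp: nb_def)
        ultimately show ?thesis by (simp add: card_mono)
      qed
      finally show "(1 / 2 + \<eta>) * real (card A) \<le> real (card (\<Union>v\<in>X. nb D A (v, s)))" .
    qed (use finW AW mu eta in auto)
    \<comment> \<open>At the start all of \<open>A\<close> is free. One sign accounts for at least
      half of \<open>X\<close>; its vertices expand by \<open>big\<close> if there are at least
      \<open>\<mu>\<close> of them, and otherwise by (A2), where the factor 8 becomes at least 4
      relative to \<open>X\<close>.\<close>
    have ext0: "ext (\<lambda>_. 2) A"
      unfolding extendable_def
    proof (intro allI impI)
      fix X :: "('a \<times> dirn) set" assume X: "X \<subseteq> W \<times> UNIV" "card X \<le> 2 * (2 * \<mu>)"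
      have finX: "finite X" using X finite_L by (rule_tac finite_subset)
      let ?X = "\<lambda>s. {v. (v, s) \<in> X}"
      have sub: "card (\<Union>v\<in>?X s. nb D A (v, s)) \<le> card (\<Union>(nb D A ` X) \<inter> A)" for s
        using finite_A nb_subset by (intro card_mono) auto
      have "card X \<le> 2 * card (?X Plus) \<or> card X \<le> 2 * card (?X Minus)"
        using card_split[OF finX] by linarith
      then obtain s where s: "card X \<le> 2 * card (?X s)" by blast
      have XW: "?X s \<subseteq> W" using X by auto
      have "2 * card X \<le> card (\<Union>v\<in>?X s. nb D A (v, s))"
      proof (cases "\<mu> \<le> card (?X s)")
        case True
        have "8 * real \<mu> \<le> \<eta> * real (card A)" using budget by simp
        also have "\<dots> \<le> (1 / 2 + \<eta>) * real (card A)" by (intro mult_right_mono) auto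
        also have "\<dots> \<le> real (card (\<Union>v\<in>?X s. nb D A (v, s)))" by (rule big[OF XW True])
        finally show ?thesis using X(2) by linarith
      next
        case False
        then have "real (card (?X s)) \<le> 2 * m" using mu mpos by linarith
        from expand[OF XW this, of s] show ?thesis using s by linarith
      qed
      then show "sum (\<lambda>_. 2) X \<le> card (\<Union>(nb D A ` X) \<inter> A)" using sub[of s] by simp
    qed
    show "weakly_connected_in V (D \<restriction> (A \<union> V))"
      unfolding weakly_connected_in_def
    proof (intro allI impI)
      fix E assume E: "disjoint_edges_on V E"
      let ?D = "D \<restriction> (A \<union> V)"
      show "\<exists>p. pre_digraph.cycle (with_proj (add_edges ?D E)) p \<and> E \<subseteq> set p"
      proof (cases "E = {}")
        case True
        have "\<exists>p. pre_digraph.cycle (with_proj (add_edges ?D {})) p"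
        proof (rule exists_cycle[OF finA])
          show "\<forall>u\<in>A. \<exists>v\<in>A. (u, v) \<in> arcs_ends ?D"
          proof
            fix v assume v: "v \<in> A"
            then have "0 < deg_in D Plus v A" using degA[of v Plus] AW upos by force
            then have "{w \<in> A. v \<rightarrow>\<^bsub>D\<^esub> w} \<noteq> {}" unfolding deg_in_def by (auto simp: card_gt_0_iff)
            then show "\<exists>w\<in>A. (v, w) \<in> arcs_ends ?D" using v by (auto simp: arcs_ends_induce)
          qed
          show "arcs_ends ?D \<subseteq> verts ?D \<times> verts ?D" by (auto simp: arcs_ends_conv)
        qed (use cA in auto)
        then show ?thesis using True by auto
      next
        case False
        have EV: "E \<subseteq> V \<times> V" and Eloop: "\<forall>e\<in>E. fst e \<noteq> snd e"
          and Edisj: "\<forall>e\<in>E. \<forall>f\<in>E. e \<noteq> f \<longrightarrow> {fst e, snd e} \<inter> {fst f, snd f} = {}"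
          using E unfolding disjoint_edges_on_def by auto
        have finE: "finite E" using EV finV by (meson finite_SigmaI finite_subset)
        define paths where "paths = (\<lambda>e. [fst e, snd e]) ` E"
        have cp: "card paths = card E" unfolding paths_def by (intro card_image) (auto simp: inj_on_def)
        have "inj_on fst E"
        proof (rule inj_onI)
          fix e f assume "e \<in> E" "f \<in> E" "fst e = fst f"
          then show "e = f" using Edisj by blast
        qed
        moreover have "fst ` E \<subseteq> V" using EV by auto
        ultimately have cEV: "card E \<le> card V" using finV by (metis card_inj_on_le)
        obtain t where t: "card E = Suc t" using False finE by (metis card_0_eq not0_implies_Suc)
        \<comment> \<open>By the inequality of arithmetic and geometric means, 16 times the square
          root is at most 8 times each of its two factors. This explains the coefficients 9 = 1 + 8
          and 28 = 20 + 8 in \<open>budget\<close>.\<close>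
        have sq: "2 * sqrt (real \<mu> * real (Suc t)) \<le> real \<mu> + real (Suc t)"
          using arith_geo_mean_sqrt[of "real \<mu>" "real (Suc t)"] by simp
        have "\<exists>c. c \<noteq> [] \<and> distinct c \<and> set c \<subseteq> W \<and>
            successively (\<lambda>u v. u \<rightarrow>\<^bsub>D\<^esub> v \<or> (u, v) \<in> E) (c @ [hd c]) \<and>
            (\<forall>(u, v)\<in>E. \<exists>as bs. c = as @ u # v # bs)"
        proof (rule link_paths[where \<P> = paths and n = t and E = E and F = A])
          show "finite paths" unfolding paths_def using finE by simp
          show "card paths = Suc t" using cp t by simp
          show "\<forall>a\<in>paths. a \<noteq> [] \<and> distinct a \<and> set a \<subseteq> W \<and> set a \<inter> A = {} \<and>
              successively (\<lambda>u v. u \<rightarrow>\<^bsub>D\<^esub> v \<or> (u, v) \<in> E) a"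
            using EV Eloop VW AV unfolding paths_def by fastforce
          show "\<forall>a\<in>paths. \<forall>b\<in>paths. a \<noteq> b \<longrightarrow> set a \<inter> set b = {}"
            using Edisj unfolding paths_def by auto
          show "ext (demand (last ` paths) (hd ` paths) A) A"
            using ext0 by (rule extendable_mono) (rule demand_le)
          show "\<forall>(u, v)\<in>E. \<exists>a\<in>paths. \<exists>as bs. a = as @ u # v # bs"
          proof clarify
            fix u v assume "(u, v) \<in> E"
            then have "[] @ u # v # [] \<in> paths" unfolding paths_def by force
            then show "\<exists>a\<in>paths. \<exists>as bs. a = as @ u # v # bs" by blast
          qed
          have "real (Suc t) \<le> real (card V)" using cEV t by simp
          then show "real (card (A - A)) + real (Suc t) + 16 * sqrt (real \<mu> * real (Suc t)) + 20 * real \<mu>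
              < \<eta> * real (card A)" using sq budget by simp
        qed simp
        then obtain c where c: "c \<noteq> []" "distinct c" "set c \<subseteq> W"
          "successively (\<lambda>u v. u \<rightarrow>\<^bsub>D\<^esub> v \<or> (u, v) \<in> E) (c @ [hd c])"
          "\<forall>(u, v)\<in>E. \<exists>as bs. c = as @ u # v # bs" by blast
        have "set (c @ [hd c]) \<subseteq> W" using c by auto
        then have "successively (\<lambda>u v. (u, v) \<in> arcs_ends ?D \<union> E) (c @ [hd c])"
          using c(4) unfolding W_def by (auto intro!: successively_mono[OF c(4)] simp: arcs_ends_induce)
        then have "pre_digraph.cycle (with_proj (add_edges ?D E)) (zip c (tl c @ [hd c]))"
          using c unfolding W_def by (intro cycle_zip) auto
        moreover have "E \<subseteq> set (zip c (tl c @ [hd c]))"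
        proof (rule subrelI)
          fix u v assume uv: "(u, v) \<in> E"
          have "\<exists>as bs. c = as @ u # v # bs" using bspec[OF c(5) uv] by (simp only: prod.case)
          then obtain as bs where c_eq: "c = as @ u # v # bs" by (elim exE)
          show "(u, v) \<in> set (zip c (tl c @ [hd c]))"
            using mem_zip_cycle[of u v as bs "[hd c]"] unfolding c_eq[symmetric] .
        qed
        ultimately show ?thesis by blast
      qed
    qed
  qed
qed

end
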